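(* For every $D\in\{\mathbb C,\mathbb H,\mathbb O\}$, with $d=\dim_{\mathbb R}D$, there is an isomorphism of real rank-$d$ vector bundles $$E_D\cong\gamma^{\oplus d}\qquad\text{over }\mathbb{RP}^d,$$ where $E_D$ is the coordinate-deletion bundle of $D$ (defined in the context) and $\gamma$ is the tautological real line bundle. In particular, $E_{\mathbb O}\cong\gamma^{\oplus 8}$ over $\mathbb{RP}^8$.
   Context: $D$ is one of the real composition division algebras $\mathbb C,\mathbb H,\mathbb O$ (octonions; not associative), of dimension $d\in\{2,4,8\}$, with its multiplicative positive-definite quadratic norm $N$, $N(uv)=N(u)N(v)$. Fix an ordered orthonormal basis $(e_0,\dots,e_{d-1})$ of $D$ with respect to the polar form $\langle u,v\rangle=\frac12(N(u+v)-N(u)-N(v))$. For $u\in D$, $L_u(v)=uv$ and $M(u)\in M_d(\mathbb R)$ is the matrix of $L_u$ in this basis. On $\mathbb{RP}^d=\{[\alpha_0:\cdots:\alpha_d]\}$ let $U_i=\{\alpha_i\neq0\}$ ($i=0,\dots,d$), let $\sigma_i:\{0,\dots,d-1\}\to\{0,\dots,d\}\setminus\{i\}$ be the increasing bijection, define $q_i:U_i\to D$ by $q_i([\alpha])=\sum_{r=0}^{d-1}\frac{\alpha_{\sigma_i(r)}}{\alpha_i}e_r$, and put $M_i(p)=M(q_i(p))$. The bundle $E_D\to\mathbb{RP}^d$ is the rank-$d$ real vector bundle obtained by gluing the $U_i\times\mathbb R^d$ via the transition functions $g_{ij}=M_iM_j^{-1}:U_i\cap U_j\to\mathrm{GL}_d(\mathbb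 R)$ for $i\ne j$ (and $g_{ii}=I_d$), with the convention that local representatives of a vector satisfy $w_i=g_{ij}w_j$. *)

theory Defs
  imports "HOL-Analysis.Analysis"
begin

section \<open>The real composition division algebras\<close>

text \<open>The quaternions and the octonions are obtained from the complex numbers by the
  Cayley--Dickson doubling \<open>A \<mapsto> A \<times> A\<close>.\<close>

definition cd_mult :: "('a \<Rightarrow> 'a \<Rightarrow> 'a::ab_group_add) \<Rightarrow> ('a \<Rightarrow> 'a) \<Rightarrow> 'a \<times> 'a \<Rightarrow> 'a \<times> 'a \<Rightarrow> 'a \<times> 'a" where
  "cd_mult m c x y =
     (m (fst x) (fst y) - m (c (snd y)) (snd x), m (snd y) (fst x) + m (snd x) (c (fst y)))"

definition cd_cnj :: "('a::ab_group_add \<Rightarrow> 'a) \<Rightarrow> 'a \<times> 'a \<Rightarrow> 'a \<times> 'a" where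
  "cd_cnj c x = (c (fst x), - snd x)"

type_synonym quaternion = "complex \<times> complex"
type_synonym octonion = "quaternion \<times> quaternion"

definition quat_mult :: "quaternion \<Rightarrow> quaternion \<Rightarrow> quaternion" where
  "quat_mult = cd_mult (*) cnj"

definition quat_cnj :: "quaternion \<Rightarrow> quaternion" where
  "quat_cnj = cd_cnj cnj"

definition oct_mult :: "octonion \<Rightarrow> octonion \<Rightarrow> octonion" where
  "oct_mult = cd_mult quat_mult quat_cnj"

definition oct_cnj :: "octonion \<Rightarrow> octonion" where
  "oct_cnj = cd_cnj quat_cnj"

text \<open>On all three algebras the multiplicative quadratic norm is the square of the library's
  norm: on products, the latter is the Euclidean one.\<close>

definition quad_norm :: "'a::euclidean_space \<Rightarrow> real" where
  "quad_norm u = (norm u)\<^sup>2"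

definition polar_form :: "'a::euclidean_space \<Rightarrow> 'a \<Rightarrow> real" where
  "polar_form u v = (quad_norm (u + v) - quad_norm u - quad_norm v) / 2"

lemma quad_norm_complex: "quad_norm (z::complex) = (Re z)\<^sup>2 + (Im z)\<^sup>2"
  by (simp add: quad_norm_def cmod_power2)

lemma quad_norm_Pair: "quad_norm (a, b) = quad_norm a + quad_norm b"
  by (simp add: quad_norm_def norm_Pair)

lemma polar_form_inner: "polar_form u v = u \<bullet> v"
  by (simp add: polar_form_def quad_norm_def power2_norm_eq_inner inner_add_left inner_add_right
      inner_commute)

lemma quad_norm_times_complex: "quad_norm ((u::complex) * v) = quad_norm u * quad_norm v"
  by (simp add: quad_norm_def norm_mult power_mult_distrib)

lemma quad_norm_quat_mult: "quad_norm (quat_mult u v) = quad_norm u * quad_norm v"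
  by (cases u; cases v)
    (simp add: quat_mult_def cd_mult_def quad_norm_Pair quad_norm_complex power2_eq_square
      algebra_simps)

lemma quad_norm_quat_cnj: "quad_norm (quat_cnj u) = quad_norm u"
  by (cases u) (simp add: quat_cnj_def cd_cnj_def quad_norm_Pair quad_norm_complex)

lemma inner_quat_mult_exchange:
  "quat_mult a c \<bullet> quat_mult (quat_cnj d) b = quat_mult d a \<bullet> quat_mult b (quat_cnj c)"
  by (cases a; cases b; cases c; cases d)
    (simp add: quat_mult_def cd_mult_def quat_cnj_def cd_cnj_def inner_complex_def algebra_simps)

lemma quad_norm_oct_mult: "quad_norm (oct_mult u v) = quad_norm u * quad_norm v"
proof -
  obtain a b c d where uv: "u = (a, b)" "v = (c, d)" by (metis surj_pair)
  have plus: "quad_norm (x + y) = quad_norm x + quad_norm y + 2 * (x \<bullet> y)"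
    and minus: "quad_norm (x - y) = quad_norm x + quad_norm y - 2 * (x \<bullet> y)" for x y :: quaternion
    by (simp_all add: quad_norm_def power2_norm_eq_inner inner_simps inner_commute[of y x])
  have "quad_norm (oct_mult u v) =
      quad_norm (quat_mult a c - quat_mult (quat_cnj d) b) +
      quad_norm (quat_mult d a + quat_mult b (quat_cnj c))"
    by (simp add: uv oct_mult_def cd_mult_def quad_norm_Pair)
  also have "\<dots> = quad_norm a * quad_norm c + quad_norm d * quad_norm b
      + (quad_norm d * quad_norm a + quad_norm b * quad_norm c)"
    unfolding plus minus quad_norm_quat_mult quad_norm_quat_cnj inner_quat_mult_exchange by simp
  also have "\<dots> = quad_norm u * quad_norm v"
    by (simp add: uv quad_norm_Pair algebra_simps)
  finally show ?thesis .
qed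

lemma quat_mult_unit: "quat_mult (1, 0) u = u" "quat_mult u (1, 0) = u"
  by (cases u; simp add: quat_mult_def cd_mult_def)+

lemma oct_mult_unit: "oct_mult ((1, 0), 0) u = u" "oct_mult u ((1, 0), 0) = u"
  by (simp_all add: oct_mult_def quat_mult_def quat_cnj_def cd_mult_def cd_cnj_def prod_eq_iff)

lemma quat_mult_cnj: "quat_mult u (quat_cnj u) = quad_norm u *\<^sub>R (1, 0)"
proof -
  obtain a b where u: "u = (a, b)" by fastforce
  have "a * cnj a + b * cnj b = complex_of_real (quad_norm a + quad_norm b)"
    by (simp add: complex_mult_cnj quad_norm_complex)
  then show ?thesis
    by (simp add: u quat_mult_def quat_cnj_def cd_mult_def cd_cnj_def quad_norm_Pair
        scaleR_conv_of_real mult.commute)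
qed

text \<open>The basis is indexed by an ordered finite type; for the numeral type of cardinality
  \<open>d\<close> this is \<open>0 < 1 < \<dots> < d - 1\<close>.\<close>

definition orthonormal_basis :: "('n::finite \<Rightarrow> 'a::euclidean_space) \<Rightarrow> bool" where
  "orthonormal_basis e \<longleftrightarrow>
     (\<forall>r s. polar_form (e r) (e s) = (if r = s then 1 else 0)) \<and> span (range e) = UNIV"

definition left_mult_matrix ::
  "('a \<Rightarrow> 'a \<Rightarrow> 'a) \<Rightarrow> ('n::finite \<Rightarrow> 'a::euclidean_space) \<Rightarrow> 'a \<Rightarrow> real^'n^'n" where
  "left_mult_matrix m e u = (\<chi> r s. representation (range e) (m u (e s)) (e r))"


section \<open>Real projective space\<close>

definition quotient_topology :: "'a topology \<Rightarrow> ('a \<Rightarrow> 'b) \<Rightarrow> 'b topology" where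
  "quotient_topology X f =
     topology (\<lambda>V. V \<subseteq> f ` topspace X \<and> openin X {x \<in> topspace X. f x \<in> V})"

lemma openin_quotient_topology:
  "openin (quotient_topology X f) V \<longleftrightarrow>
     V \<subseteq> f ` topspace X \<and> openin X {x \<in> topspace X. f x \<in> V}"
proof -
  have "{x \<in> topspace X. f x \<in> S \<inter> T} = {x \<in> topspace X. f x \<in> S} \<inter> {x \<in> topspace X. f x \<in> T}"
    for S T by auto
  moreover have "{x \<in> topspace X. f x \<in> \<Union>\<K>} = (\<Union>K\<in>\<K>. {x \<in> topspace X. f x \<in> K})" for \<K>
    by auto
  ultimately have "istopology (\<lambda>V. V \<subseteq> f ` topspace X \<and> openin X {x \<in> topspace X. f x \<in> V})"
    unfolding istopology_def by auto
  then show ?thesis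
    by (simp add: quotient_topology_def topology_inverse')
qed

lemma topspace_quotient_topology: "topspace (quotient_topology X f) = f ` topspace X"
proof
  have "{x \<in> topspace X. f x \<in> f ` topspace X} = topspace X" by auto
  then have "openin (quotient_topology X f) (f ` topspace X)"
    by (simp add: openin_quotient_topology)
  then show "f ` topspace X \<subseteq> topspace (quotient_topology X f)"
    by (rule openin_subset)
  show "topspace (quotient_topology X f) \<subseteq> f ` topspace X"
    using openin_topspace[of "quotient_topology X f"] unfolding openin_quotient_topology by blast
qed

lemma quotient_map_quotient_topology: "quotient_map X (quotient_topology X f) f"
  by (auto simp: quotient_map_def topspace_quotient_topology openin_quotient_topology)

text \<open>A point \<open>[\<alpha>]\<close> of projective space is the line \<open>span {\<alpha>}\<close>.\<close>

definition real_projective_space :: "(real^'m) set topology" where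
  "real_projective_space = quotient_topology (subtopology euclidean (- {0})) (\<lambda>\<alpha>. span {\<alpha>})"

definition hom_coords :: "(real^'m) set \<Rightarrow> real^'m" where
  "hom_coords p = (SOME \<alpha>. \<alpha> \<noteq> 0 \<and> span {\<alpha>} = p)"

definition coord_chart :: "'m::finite \<Rightarrow> (real^'m) set set" where
  "coord_chart i = {p \<in> topspace real_projective_space. hom_coords p $ i \<noteq> 0}"

definition deletion_index :: "'m::linorder \<Rightarrow> 'n::linorder \<Rightarrow> 'm" where
  "deletion_index i = (THE \<sigma>. strict_mono \<sigma> \<and> range \<sigma> = - {i})"

definition affine_coord ::
  "('n::{finite,linorder} \<Rightarrow> 'a::euclidean_space) \<Rightarrow> 'm \<Rightarrow> (real^'m::{finite,linorder}) set \<Rightarrow> 'a" where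
  "affine_coord e i p =
     (\<Sum>r\<in>UNIV. (hom_coords p $ deletion_index i r / hom_coords p $ i) *\<^sub>R e r)"

lemma ex_strict_mono_enum:
  fixes A :: "'a::linorder set"
  assumes "finite A"
  shows "\<exists>f. bij_betw f {..<card A} A \<and> strict_mono_on {..<card A} f"
proof -
  have "bij_betw (\<lambda>k. sorted_list_of_set A ! k) {..<card A} A"
    using assms by (intro bij_betw_nth) auto
  moreover have "strict_mono_on {..<card A} (\<lambda>k. sorted_list_of_set A ! k)"
    using sorted_wrt_nth_less[OF strict_sorted_list_of_set[of A]]
    by (auto simp: strict_mono_on_def)
  ultimately show ?thesis by blast
qed

lemma deletion_index:
  fixes i :: "'m::{finite,linorder}"
  assumes "CARD('m) = CARD('n::{finite,linorder}) + 1"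
  shows "strict_mono (deletion_index i :: 'n \<Rightarrow> 'm)"
    and "range (deletion_index i :: 'n \<Rightarrow> 'm) = - {i}"
proof -
  have "\<exists>!\<sigma> :: 'n \<Rightarrow> 'm. strict_mono \<sigma> \<and> range \<sigma> = - {i}"
  proof (rule ex_ex1I)
    have "card (- {i}) = CARD('n)"
      using assms by (simp add: Compl_eq_Diff_UNIV)
    then obtain g where g: "bij_betw g {..<CARD('n)} (- {i})" "strict_mono_on {..<CARD('n)} g"
      using ex_strict_mono_enum[of "- {i}"] by auto
    obtain f where f: "bij_betw f {..<CARD('n)} (UNIV :: 'n set)" "strict_mono_on {..<CARD('n)} f"
      using ex_strict_mono_enum[of "UNIV :: 'n set"] by auto
    define h where "h = the_inv_into {..<CARD('n)} f"
    have h: "bij_betw h UNIV {..<CARD('n)}"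
      unfolding h_def by (rule bij_betw_the_inv_into[OF f(1)])
    have fh: "f (h x) = x" for x
      unfolding h_def using f(1) by (simp add: bij_betw_def f_the_inv_into_f)
    have hin: "h x \<in> {..<CARD('n)}" for x using h by (auto simp: bij_betw_def)
    have "h x < h y" if "x < y" for x y
    proof (rule ccontr)
      assume "\<not> h x < h y"
      then have "f (h y) \<le> f (h x)"
        using monotone_onD[OF strict_mono_on_imp_mono_on[OF f(2)]] hin by (simp add: not_less)
      with that show False by (simp add: fh)
    qed
    then have "strict_mono (g \<circ> h)"
      using g(2) hin by (auto simp: strict_mono_def strict_mono_on_def)
    moreover have "range (g \<circ> h) = - {i}"
      using bij_betw_trans[OF h g(1)] by (simp add: bij_betw_def)
    ultimately show "\<exists>\<sigma> :: 'n \<Rightarrow> 'm. strict_mono \<sigma> \<and> range \<sigma> = - {i}" by blast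
  next
    fix \<sigma> \<tau> :: "'n \<Rightarrow> 'm"
    assume s: "strict_mono \<sigma> \<and> range \<sigma> = - {i}" and t: "strict_mono \<tau> \<and> range \<tau> = - {i}"
    have "\<sigma> x = \<tau> x" for x
    proof (induction x rule: measure_induct_rule[where f = "\<lambda>x. card {..<x}"])
      case (less x)
      have IH: "\<sigma> y = \<tau> y" if "y < x" for y
        using that by (intro less psubset_card_mono) auto
      have le: "\<rho> x \<le> \<pi> x" if "strict_mono \<rho>" "range \<rho> = - {i}" "strict_mono \<pi>"
        "range \<pi> = - {i}" "\<And>y. y < x \<Longrightarrow> \<rho> y = \<pi> y" for \<rho> \<pi> :: "'n \<Rightarrow> 'm"
      proof -
        have "\<pi> x \<in> range \<rho>" using that(2,4) by blast
        then obtain z where z: "\<pi> x = \<rho> z" by blast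
        have "\<not> z < x"
        proof
          assume "z < x"
          then have "\<pi> x = \<pi> z" using that(5) z by simp
          with \<open>z < x\<close> that(3) show False by (simp add: strict_mono_eq)
        qed
        then show ?thesis using z that(1) by (simp add: strict_mono_less_eq not_less)
      qed
      show ?case
        using le[of \<sigma> \<tau>] le[of \<tau> \<sigma>] s t IH by (simp add: antisym)
    qed
    then show "\<sigma> = \<tau>" by blast
  qed
  then have *: "strict_mono (deletion_index i :: 'n \<Rightarrow> 'm) \<and> range (deletion_index i :: 'n \<Rightarrow> 'm) = - {i}"
    unfolding deletion_index_def by (rule theI')
  show "strict_mono (deletion_index i :: 'n \<Rightarrow> 'm)"
    and "range (deletion_index i :: 'n \<Rightarrow> 'm) = - {i}"
    using * by blast+
qed

text \<open>Neither the charts nor their coordinates depend on the chosen homogeneous coordinates.\<close>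

lemma hom_coords_span:
  assumes "\<alpha> \<noteq> (0 :: real^'m)"
  obtains c where "c \<noteq> 0" "hom_coords (span {\<alpha>}) = c *\<^sub>R \<alpha>"
proof -
  let ?h = "hom_coords (span {\<alpha>})"
  have h: "?h \<noteq> 0" "span {?h} = span {\<alpha>}"
    unfolding hom_coords_def using someI[of "\<lambda>\<beta>. \<beta> \<noteq> 0 \<and> span {\<beta>} = span {\<alpha>}" \<alpha>] assms by auto
  then have "?h \<in> span {\<alpha>}" by (metis insertI1 span_base)
  then obtain c where "?h = c *\<^sub>R \<alpha>" by (auto simp: span_singleton)
  with h(1) that show thesis by auto
qed

lemma coord_chart_span:
  assumes "\<alpha> \<noteq> (0 :: real^'m)"
  shows "span {\<alpha>} \<in> coord_chart i \<longleftrightarrow> \<alpha> $ i \<noteq> 0"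
proof -
  obtain c where "c \<noteq> 0" "hom_coords (span {\<alpha>}) = c *\<^sub>R \<alpha>" using hom_coords_span[OF assms] .
  with assms show ?thesis
    by (auto simp: coord_chart_def real_projective_space_def topspace_quotient_topology)
qed

lemma affine_coord_span:
  fixes \<alpha> :: "real^'m::{finite,linorder}"
  assumes "\<alpha> $ i \<noteq> 0"
  shows "affine_coord e i (span {\<alpha>}) = (\<Sum>r\<in>UNIV. (\<alpha> $ deletion_index i r / \<alpha> $ i) *\<^sub>R e r)"
proof -
  have "\<alpha> \<noteq> 0" using assms by auto
  then obtain c where "c \<noteq> 0" "hom_coords (span {\<alpha>}) = c *\<^sub>R \<alpha>" using hom_coords_span by blast
  then show ?thesis by (simp add: affine_coord_def)
qed


section \<open>Real vector bundles\<close>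

record ('e, 'b) vbundle =
  tot_space :: "'e topology"
  base_space :: "'b topology"
  bproj :: "'e \<Rightarrow> 'b"
  vadd :: "'e \<Rightarrow> 'e \<Rightarrow> 'e"
  vscale :: "real \<Rightarrow> 'e \<Rightarrow> 'e"

text \<open>The operations only matter on pairs of vectors over the same point. The vector space axioms
  on the fibres are not listed since they are inherited from \<open>real^'n\<close>: a local trivialisation
  restricts on each fibre to a bijection onto \<open>real^'n\<close> compatible with the operations.\<close>

definition local_trivialization ::
  "('e, 'b) vbundle \<Rightarrow> 'b set \<Rightarrow> ('e \<Rightarrow> 'b \<times> (real^'n)) \<Rightarrow> bool" where
  "local_trivialization E U h \<longleftrightarrow>
     homeomorphic_map (subtopology (tot_space E) {x. bproj E x \<in> U})
       (prod_topology (subtopology (base_space E) U) euclidean) h \<and>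
     (\<forall>x \<in> topspace (tot_space E). bproj E x \<in> U \<longrightarrow>
        fst (h x) = bproj E x \<and>
        (\<forall>c. snd (h (vscale E c x)) = c *\<^sub>R snd (h x)) \<and>
        (\<forall>y \<in> topspace (tot_space E). bproj E y = bproj E x \<longrightarrow>
           snd (h (vadd E x y)) = snd (h x) + snd (h y)))"

definition vector_bundle :: "'n::finite itself \<Rightarrow> ('e, 'b) vbundle \<Rightarrow> bool" where
  "vector_bundle _ E \<longleftrightarrow>
     continuous_map (tot_space E) (base_space E) (bproj E) \<and>
     (\<forall>x \<in> topspace (tot_space E). \<forall>c.
        vscale E c x \<in> topspace (tot_space E) \<and> bproj E (vscale E c x) = bproj E x) \<and>
     (\<forall>x \<in> topspace (tot_space E). \<forall>y \<in> topspace (tot_space E). bproj E x = bproj E y \<longrightarrow>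
        vadd E x y \<in> topspace (tot_space E) \<and> bproj E (vadd E x y) = bproj E x) \<and>
     (\<forall>b \<in> topspace (base_space E). \<exists>U (h :: 'e \<Rightarrow> 'b \<times> (real^'n)).
        openin (base_space E) U \<and> b \<in> U \<and> local_trivialization E U h)"

definition bundle_isomorphism ::
  "('e, 'b) vbundle \<Rightarrow> ('f, 'b) vbundle \<Rightarrow> ('e \<Rightarrow> 'f) \<Rightarrow> bool" where
  "bundle_isomorphism E F \<phi> \<longleftrightarrow>
     homeomorphic_map (tot_space E) (tot_space F) \<phi> \<and>
     (\<forall>x \<in> topspace (tot_space E).
        bproj F (\<phi> x) = bproj E x \<and>
        (\<forall>c. \<phi> (vscale E c x) = vscale F c (\<phi> x)) \<and>
        (\<forall>y \<in> topspace (tot_space E). bproj E y = bproj E x \<longrightarrow>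
           \<phi> (vadd E x y) = vadd F (\<phi> x) (\<phi> y)))"

definition isomorphic_vector_bundles ::
  "'n::finite itself \<Rightarrow> ('e, 'b) vbundle \<Rightarrow> ('f, 'b) vbundle \<Rightarrow> bool" where
  "isomorphic_vector_bundles N E F \<longleftrightarrow>
     vector_bundle N E \<and> vector_bundle N F \<and> base_space E = base_space F \<and>
     (\<exists>\<phi>. bundle_isomorphism E F \<phi>)"

definition taut_bundle :: "'m::finite itself \<Rightarrow> ((real^'m) set \<times> (real^'m), (real^'m) set) vbundle" where
  "taut_bundle _ =
     \<lparr>tot_space = subtopology (prod_topology real_projective_space euclidean) {(p, v). v \<in> p},
      base_space = real_projective_space,
      bproj = fst,
      vadd = (\<lambda>x y. (fst x, snd x + snd y)),
      vscale = (\<lambda>c x. (fst x, c *\<^sub>R snd x))\<rparr>"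

text \<open>The Whitney sum of copies of \<open>E\<close> indexed by \<open>'n\<close>, realised as the fibre product over the
  base: a vector over \<open>b\<close> is a pair \<open>(b, f)\<close> where each \<open>f k\<close> is a vector of \<open>E\<close> over \<open>b\<close>.\<close>

definition whitney_power :: "'n::finite itself \<Rightarrow> ('e, 'b) vbundle \<Rightarrow> ('b \<times> ('n \<Rightarrow> 'e), 'b) vbundle" where
  "whitney_power _ E =
     \<lparr>tot_space = subtopology
        (prod_topology (base_space E) (product_topology (\<lambda>_. tot_space E) UNIV))
        {(b, f). \<forall>k. bproj E (f k) = b},
      base_space = base_space E,
      bproj = fst,
      vadd = (\<lambda>x y. (fst x, \<lambda>k. vadd E (snd x k) (snd y k))),
      vscale = (\<lambda>c x. (fst x, \<lambda>k. vscale E c (snd x k)))\<rparr>"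


section \<open>Gluing along transition functions\<close>

text \<open>A triple \<open>(i, p, w)\<close> is the vector over \<open>p\<close> whose local representative in the \<open>i\<close>-th
  trivialisation is \<open>w\<close>; two triples are identified if \<open>w\<^sub>i = g\<^sub>i\<^sub>j w\<^sub>j\<close>.\<close>

definition glue_rel ::
  "('i \<Rightarrow> 'b set) \<Rightarrow> ('i \<Rightarrow> 'i \<Rightarrow> 'b \<Rightarrow> real^'n^'n) \<Rightarrow>
   (('i \<times> 'b \<times> (real^'n)) \<times> ('i \<times> 'b \<times> (real^'n))) set" where
  "glue_rel U g = {((i, p, w), (j, p', w')). p \<in> U i \<inter> U j \<and> p' = p \<and> w = g i j p *v w'}"

definition glue_class ::
  "('i \<Rightarrow> 'b set) \<Rightarrow> ('i \<Rightarrow> 'i \<Rightarrow> 'b \<Rightarrow> real^'n^'n) \<Rightarrow>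
   ('i \<times> 'b \<times> (real^'n)) \<Rightarrow> ('i \<times> 'b \<times> (real^'n)) set" where
  "glue_class U g x = glue_rel U g `` {x}"

lemma equiv_glue_rel:
  fixes g :: "'i \<Rightarrow> 'i \<Rightarrow> 'b \<Rightarrow> real^'n^'n"
  assumes refl: "\<And>i p. p \<in> U i \<Longrightarrow> g i i p = mat 1"
    and cocycle: "\<And>i j k p. p \<in> U i \<inter> U j \<inter> U k \<Longrightarrow> g i j p ** g j k p = g i k p"
  shows "equiv {(i, p, w). p \<in> U i} (glue_rel U g)"
proof (rule equivI)
  show "glue_rel U g \<subseteq> {(i, p, w). p \<in> U i} \<times> {(i, p, w). p \<in> U i}"
    by (auto simp: glue_rel_def)
  show "refl_on {(i, p, w). p \<in> U i} (glue_rel U g)"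
    by (auto simp: refl_on_def glue_rel_def refl)
  show "sym (glue_rel U g)"
    by (auto simp: sym_def glue_rel_def matrix_vector_mul_assoc cocycle refl)
  show "trans (glue_rel U g)"
    by (auto simp: trans_def glue_rel_def matrix_vector_mul_assoc cocycle)
qed

definition glued_bundle ::
  "'b topology \<Rightarrow> ('i \<Rightarrow> 'b set) \<Rightarrow> ('i \<Rightarrow> 'i \<Rightarrow> 'b \<Rightarrow> real^'n^'n) \<Rightarrow>
   (('i \<times> 'b \<times> (real^'n)) set, 'b) vbundle" where
  "glued_bundle X U g =
     \<lparr>tot_space = quotient_topology
        (subtopology (prod_topology (discrete_topology UNIV) (prod_topology X euclidean))
          {(i, p, w). p \<in> U i}) (glue_class U g),
      base_space = X,
      bproj = (\<lambda>x. THE p. \<exists>i w. (i, p, w) \<in> x),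
      vadd = (\<lambda>x y. THE z. \<exists>i p v w. p \<in> U i \<and> x = glue_class U g (i, p, v) \<and>
        y = glue_class U g (i, p, w) \<and> z = glue_class U g (i, p, v + w)),
      vscale = (\<lambda>c x. THE z. \<exists>i p v. p \<in> U i \<and> x = glue_class U g (i, p, v) \<and>
        z = glue_class U g (i, p, c *\<^sub>R v))\<rparr>"


section \<open>The coordinate-deletion bundle\<close>

text \<open>\<open>m\<close> is the multiplication of the algebra, \<open>e\<close> the ordered orthonormal basis.\<close>

definition chart_matrix ::
  "('a \<Rightarrow> 'a \<Rightarrow> 'a) \<Rightarrow> ('n \<Rightarrow> 'a::euclidean_space) \<Rightarrow>
   'm \<Rightarrow> (real^'m::{finite,linorder}) set \<Rightarrow> real^'n::{finite,linorder}^'n::{finite,linorder}" where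
  "chart_matrix m e i p = left_mult_matrix m e (affine_coord e i p)"

definition deletion_transition ::
  "('a \<Rightarrow> 'a \<Rightarrow> 'a) \<Rightarrow> ('n \<Rightarrow> 'a::euclidean_space) \<Rightarrow>
   'm \<Rightarrow> 'm \<Rightarrow> (real^'m::{finite,linorder}) set \<Rightarrow> real^'n::{finite,linorder}^'n::{finite,linorder}" where
  "deletion_transition m e i j p =
     (if i = j then mat 1 else chart_matrix m e i p ** matrix_inv (chart_matrix m e j p))"

text \<open>For the coordinate-deletion bundle over the projective space of \<open>real^'m\<close> the cardinality of
  \<open>'m\<close> has to exceed that of \<open>'n\<close>, the dimension of the algebra, by one.\<close>

definition deletion_bundle ::
  "'m itself \<Rightarrow> ('a \<Rightarrow> 'a \<Rightarrow> 'a) \<Rightarrow>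
   ('n \<Rightarrow> 'a::euclidean_space) \<Rightarrow>
   (('m \<times> (real^'m::{finite,linorder}) set \<times> (real^'n::{finite,linorder})) set,
    (real^'m::{finite,linorder}) set) vbundle" where
  "deletion_bundle _ m e = glued_bundle real_projective_space coord_chart (deletion_transition m e)"

end

theory Submission
  imports Defs
begin

text \<open>
  Write \<open>L u\<close> for the matrix of left multiplication by \<open>u\<close> and \<open>P i \<alpha>\<close> for the element of the algebra
  obtained from \<open>\<alpha>\<close> by deleting the \<open>i\<close>-th coordinate. The coordinate-deletion bundle is glued by
  \<open>L (P i \<alpha>) (L (P j \<alpha>))\<^sup>-\<^sup>1\<close> up to a scalar, and \<open>\<gamma>\<^sup>d\<close> by the scalar \<open>\<alpha>\<^sub>i / \<alpha>\<^sub>j\<close>. Hence an isomorphism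
  amounts to a single matrix function \<open>G\<close> on the complement of the coordinate axes, invertible and
  homogeneous of odd degree, such that for every \<open>i\<close> the product \<open>G (L (P i \<alpha>))\<^sup>-\<^sup>1\<close> extends
  continuously over the \<open>i\<close>-th axis with an invertible value there: these products are the
  components of the isomorphism in the charts. So \<open>G\<close> has to vary, around each of the \<open>d + 1\<close> axes, like
  left multiplication by the remaining coordinates.

  Because \<open>d + 1\<close> is odd, all axes but the last can be grouped into pairs of adjacent indices. For one
  axis alone \<open>L (P i \<alpha>)\<close> itself is an odd function with the right behaviour. For two adjacent axes \<open>i < j\<close>
  there is an even one: the vector
    \<open>f \<alpha> = (\<alpha>\<^sub>i + \<alpha>\<^sub>j) P i \<alpha> - \<bar>P i \<alpha>\<bar>\<^sup>2 e\<^sub>s\<close>,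
  where \<open>s\<close> is the slot of \<open>\<alpha>\<^sub>j\<close> in \<open>P i \<alpha>\<close> (and, by adjacency, the slot of \<open>\<alpha>\<^sub>i\<close> in \<open>P j \<alpha>\<close>), is symmetric
  in \<open>i\<close> and \<open>j\<close> and satisfies \<open>\<bar>f \<alpha>\<bar> = \<bar>P i \<alpha>\<bar> \<bar>P j \<alpha>\<bar>\<close> (\<open>norm_pair_vector\<close>), so it vanishes only on the
  two axes, and to first order it is \<open>P i \<alpha>\<close> or \<open>P j \<alpha>\<close> there. On every other axis it is a multiple of
  \<open>e\<^sub>s\<close>, so that \<open>L (e\<^sub>s)\<^sup>T L (f \<alpha>)\<close> is scalar on these axes.

  The function \<open>G\<close> is the product of one odd factor and of all the even factors. Near a given axis
  exactly one factor degenerates. The factors to its right, being nearly scalar, can be moved through the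
  degenerate one: \<open>L u X (L u)\<^sup>-\<^sup>1\<close> tends to \<open>c I\<close> whenever \<open>X\<close> does, even as \<open>u\<close> tends to 0, because \<open>L u\<close> is
  a similarity (\<open>tendsto_conjugate_scalar\<close>).

  On the topological side, a bundle having local trivialisations whose transition functions are those
  of a gluing construction is isomorphic to the glued bundle (\<open>glued_bundle_isomorphic\<close>). It is
  applied to \<open>\<gamma>\<^sup>d\<close>, trivialised on the chart \<open>U\<^sub>i\<close> by the \<open>i\<close>-th coordinates of the \<open>d\<close> vectors,
  followed by the inverse of the extension of \<open>G (L (P i \<alpha>))\<^sup>-\<^sup>1\<close>.
\<close>


section \<open>Continuity of matrix operations\<close>

lemma tendsto_matrix_mult [tendsto_intros]:
  fixes A B :: "'b \<Rightarrow> real^'n::finite^'n"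
  assumes "(A \<longlongrightarrow> K) F" "(B \<longlongrightarrow> L) F"
  shows "((\<lambda>x. A x ** B x) \<longlongrightarrow> K ** L) F"
  unfolding matrix_matrix_mult_def by (intro tendsto_intros assms)

lemma continuous_on_matrix_mult [continuous_intros]:
  fixes A B :: "'b::topological_space \<Rightarrow> real^'n::finite^'n"
  assumes "continuous_on S A" "continuous_on S B"
  shows "continuous_on S (\<lambda>x. A x ** B x)"
  using assms by (auto simp: continuous_on_def intro: tendsto_matrix_mult)

lemma tendsto_matrix_transpose [tendsto_intros]:
  fixes A :: "'b \<Rightarrow> real^'n::finite^'n"
  assumes "(A \<longlongrightarrow> K) F"
  shows "((\<lambda>x. transpose (A x)) \<longlongrightarrow> transpose K) F"
  unfolding transpose_def by (intro tendsto_intros assms)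

lemma matrix_inv_mult:
  fixes A :: "real^'n::finite^'n"
  assumes "invertible A"
  shows "A ** matrix_inv A = mat 1" "matrix_inv A ** A = mat 1"
  using someI_ex[OF assms[unfolded invertible_def]] by (simp_all add: matrix_inv_def)

text \<open>Cramer's rule expresses the entries of the inverse as quotients of determinants.\<close>

lemma continuous_on_matrix_inv [continuous_intros]:
  fixes A :: "'b::topological_space \<Rightarrow> real^'n::finite^'n"
  assumes A: "continuous_on S A" and inv: "\<And>x. x \<in> S \<Longrightarrow> invertible (A x)"
  shows "continuous_on S (\<lambda>x. matrix_inv (A x))"
proof -
  have det: "det (A x) \<noteq> 0" if "x \<in> S" for x
    using inv[OF that] by (simp add: invertible_det_nz)
  have col: "matrix_inv (A x) *v b = (\<chi> k. det (\<chi> i j. if j = k then b $ i else A x $ i $ j) / det (A x))"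
    if "x \<in> S" for x b
    using cramer[OF det[OF that], of "matrix_inv (A x) *v b" b] inv[OF that]
    by (simp add: matrix_vector_mul_assoc matrix_inv_mult)
  have "matrix_inv (A x) = (\<chi> k l. det (\<chi> i j. if j = k then axis l 1 $ i else A x $ i $ j) / det (A x))"
    if "x \<in> S" for x
  proof -
    have "matrix_inv (A x) $ k $ l = (matrix_inv (A x) *v axis l 1) $ k" for k l
      by (simp add: matrix_vector_mul_component inner_axis)
    then show ?thesis by (simp add: vec_eq_iff col[OF that])
  qed
  moreover have detA: "continuous_on S (\<lambda>x. det (A x))"
    unfolding det_def by (intro continuous_intros A)
  moreover have "continuous_on S (\<lambda>x. det (\<chi> i j. if j = k then axis l 1 $ i else A x $ i $ j))" for k l
  proof -
    have "continuous_on S (\<lambda>x. if j = k then axis l 1 $ i else A x $ i $ j)" for i j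
      by (cases "j = k") (auto intro!: continuous_intros A)
    then show ?thesis
      unfolding det_def by (intro continuous_intros) auto
  qed
  then have "continuous_on S (\<lambda>x. (\<chi> k l. det (\<chi> i j. if j = k then axis l 1 $ i else A x $ i $ j) / det (A x)) :: real^'n^'n)"
    using det by (intro continuous_on_vec_lambda continuous_on_divide detA) auto
  ultimately show ?thesis
    by (simp cong: continuous_on_cong)
qed

lemma matrix_mult_scaleR:
  fixes A B :: "real^'n::finite^'n"
  shows "(c *\<^sub>R A) ** B = c *\<^sub>R (A ** B)" "A ** (c *\<^sub>R B) = c *\<^sub>R (A ** B)"
  by (simp_all add: scalar_matrix_assoc matrix_scalar_ac)

lemma matrix_add_rdistrib:
  fixes A B C :: "real^'n::finite^'n"
  shows "(A + B) ** C = A ** C + B ** C"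
  by (simp add: vec_eq_iff matrix_matrix_mult_def sum.distrib distrib_right)

lemma matrix_diff_rdistrib:
  fixes A B C :: "real^'n::finite^'n"
  shows "(A - B) ** C = A ** C - B ** C"
  by (simp add: vec_eq_iff matrix_matrix_mult_def sum_subtractf left_diff_distrib)

lemma invertible_scaleR:
  fixes A :: "real^'n::finite^'n"
  assumes "invertible A" "c \<noteq> 0"
  shows "invertible (c *\<^sub>R A)"
  using assms by (simp add: scalar_invertible)

section \<open>Left multiplications of a composition algebra\<close>

text \<open>A bilinear product with multiplicative norm. The complex numbers, the quaternions and the octonions
  are the instances of interest.\<close>

locale composition_algebra =
  fixes m :: "'a::euclidean_space \<Rightarrow> 'a \<Rightarrow> 'a" and e :: "'n::{finite,linorder} \<Rightarrow> 'a"
  assumes bilinear: "bilinear m"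
    and norm_mult: "norm (m u v) = norm u * norm v"
    and basis: "orthonormal_basis e"
begin

abbreviation M :: "'a \<Rightarrow> real^'n::{finite,linorder}^'n::{finite,linorder}" where "M \<equiv> left_mult_matrix m e"

lemma inner_basis: "e r \<bullet> e s = (if r = s then 1 else 0)"
  using basis by (simp add: orthonormal_basis_def polar_form_inner)

lemma basis_expansion: "x = (\<Sum>r\<in>UNIV. (x \<bullet> e r) *\<^sub>R e r)"
proof -
  let ?y = "x - (\<Sum>r\<in>UNIV. (x \<bullet> e r) *\<^sub>R e r)"
  have "orthogonal ?y b" if "b \<in> range e" for b
    using that by (auto simp: orthogonal_def inner_diff_left inner_sum_left inner_basis if_distrib
        cong: if_cong)
  moreover have "?y \<in> span (range e)" using basis by (simp add: orthonormal_basis_def)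
  ultimately have "orthogonal ?y ?y" by (rule orthogonal_to_span[rotated])
  then show ?thesis by (simp add: orthogonal_def)
qed

lemma inner_expansion: "x \<bullet> y = (\<Sum>r\<in>UNIV. (x \<bullet> e r) * (y \<bullet> e r))"
  by (subst basis_expansion[of y]) (simp add: inner_sum_right mult.commute)

lemma M_nth: "M u $ r $ s = m u (e s) \<bullet> e r"
proof -
  have inj: "inj e" by (rule injI) (metis inner_basis zero_neq_one)
  have nz: "e r \<noteq> 0" for r using inner_basis[of r r] by auto
  have ind: "independent (range e)"
    using nz by (intro pairwise_orthogonal_independent)
      (auto simp: pairwise_def orthogonal_def inner_basis)
  let ?x = "m u (e s)"
  have "?x = (\<Sum>b\<in>range e. representation (range e) ?x b *\<^sub>R b)"
    using ind basis by (subst real_vector.sum_representation_eq) (auto simp: orthonormal_basis_def)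
  also have "\<dots> = (\<Sum>r\<in>UNIV. representation (range e) ?x (e r) *\<^sub>R e r)"
    by (simp add: sum.reindex[OF inj])
  finally have "?x \<bullet> e r = (\<Sum>r\<in>UNIV. representation (range e) ?x (e r) *\<^sub>R e r) \<bullet> e r" by simp
  then show ?thesis
    by (simp add: left_mult_matrix_def inner_sum_left inner_basis if_distrib cong: if_cong)
qed

lemma linear_M: "linear M"
proof (rule linearI)
  show "M (u + v) = M u + M v" for u v
    by (simp add: vec_eq_iff M_nth bilinear_ladd[OF bilinear] inner_add_left)
  show "M (c *\<^sub>R u) = c *\<^sub>R M u" for c u
    by (simp add: vec_eq_iff M_nth bilinear_lmul[OF bilinear])
qed

text \<open>Polarising \<open>norm_mult\<close> shows that left multiplication by \<open>u\<close> scales inner products by the square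
  of the norm of \<open>u\<close>; its matrix is therefore a multiple of an orthogonal one.\<close>

lemma transpose_M_mult: "transpose (M u) ** M u = (norm u)\<^sup>2 *\<^sub>R mat 1"
proof -
  have pol: "m u v \<bullet> m u w = (norm u)\<^sup>2 * (v \<bullet> w)" for v w
  proof -
    have n: "m u z \<bullet> m u z = (norm u)\<^sup>2 * (z \<bullet> z)" for z
      by (simp flip: power2_norm_eq_inner add: norm_mult power_mult_distrib)
    show ?thesis
      using n[of "v + w"] n[of v] n[of w]
      by (simp add: bilinear_radd[OF bilinear] inner_simps inner_commute[of w v]
          inner_commute[of "m u w" "m u v"] algebra_simps)
  qed
  have "(transpose (M u) ** M u) $ s $ t = m u (e s) \<bullet> m u (e t)" for s t
    by (simp add: matrix_matrix_mult_def transpose_def M_nth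
        inner_expansion[of "m u (e s)" "m u (e t)"])
  then show ?thesis
    by (simp add: vec_eq_iff pol inner_basis mat_def)
qed

lemma
  assumes "u \<noteq> 0"
  shows invertible_M: "invertible (M u)"
    and matrix_inv_M: "matrix_inv (M u) = (1 / (norm u)\<^sup>2) *\<^sub>R transpose (M u)"
proof -
  let ?N = "(1 / (norm u)\<^sup>2) *\<^sub>R transpose (M u)"
  have l: "?N ** M u = mat 1"
    using assms by (simp add: matrix_mult_scaleR transpose_M_mult)
  then have r: "M u ** ?N = mat 1" by (simp add: matrix_left_right_inverse)
  show "invertible (M u)" using l r by (auto simp: invertible_def)
  then show "matrix_inv (M u) = ?N"
    by (metis l matrix_inv_mult(1) matrix_mul_assoc matrix_mul_lid matrix_mul_rid)
qed

lemma abs_M_nth_le: "\<bar>M u $ r $ s\<bar> \<le> norm u"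
proof -
  have "norm (e r) = 1" for r using inner_basis[of r r] by (simp add: norm_eq_sqrt_inner)
  then show ?thesis
    using Cauchy_Schwarz_ineq2[of "m u (e s)" "e r"] by (simp add: M_nth norm_mult)
qed

text \<open>Conjugation by \<open>M u\<close> is conjugation by the orthogonal matrix \<open>M u / norm u\<close>. It fixes the scalar
  limit and enlarges the difference from it by at most a constant factor. So the limit persists even
  where \<open>u\<close> tends to zero and \<open>matrix_inv (M u)\<close> is unbounded.\<close>

lemma tendsto_conjugate_scalar:
  assumes X: "(X \<longlongrightarrow> c *\<^sub>R mat 1) F" and u: "\<forall>\<^sub>F a in F. u a \<noteq> 0"
  shows "((\<lambda>a. M (u a) ** X a ** matrix_inv (M (u a))) \<longlongrightarrow> c *\<^sub>R mat 1) F"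
proof -
  define Y where "Y = (\<lambda>a. X a - c *\<^sub>R mat 1)"
  define Z where "Z = (\<lambda>a. M (u a) ** Y a ** matrix_inv (M (u a)))"
  have "(Y \<longlongrightarrow> 0) F" unfolding Y_def using X by (simp add: LIM_zero)
  then have Ykl: "((\<lambda>a. \<Sum>l\<in>UNIV. \<Sum>k\<in>UNIV. \<bar>Y a $ k $ l\<bar>) \<longlongrightarrow> 0) F"
    by (auto intro!: tendsto_eq_intros)
  have bound: "\<bar>Z a $ i $ j\<bar> \<le> (\<Sum>l\<in>UNIV. \<Sum>k\<in>UNIV. \<bar>Y a $ k $ l\<bar>)" if "u a \<noteq> 0" for a i j
  proof -
    have "Z a $ i $ j = (\<Sum>l\<in>UNIV. \<Sum>k\<in>UNIV. (M (u a) $ i $ k * M (u a) $ j $ l / (norm (u a))\<^sup>2) * Y a $ k $ l)"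
      by (simp add: Z_def matrix_inv_M[OF that] matrix_mult_scaleR matrix_matrix_mult_def transpose_def
          sum_distrib_left sum_distrib_right mult_ac sum_divide_distrib)
    also have "\<bar>\<dots>\<bar> \<le> (\<Sum>l\<in>UNIV. \<Sum>k\<in>UNIV. \<bar>(M (u a) $ i $ k * M (u a) $ j $ l / (norm (u a))\<^sup>2) * Y a $ k $ l\<bar>)"
      by (rule order_trans[OF sum_abs sum_mono[OF sum_abs]])
    also have "\<dots> \<le> (\<Sum>l\<in>UNIV. \<Sum>k\<in>UNIV. \<bar>Y a $ k $ l\<bar>)"
    proof (intro sum_mono)
      fix l k
      have "\<bar>M (u a) $ i $ k * M (u a) $ j $ l\<bar> \<le> norm (u a) * norm (u a)"
        unfolding abs_mult by (intro mult_mono abs_M_nth_le) auto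
      then have "\<bar>M (u a) $ i $ k * M (u a) $ j $ l / (norm (u a))\<^sup>2\<bar> \<le> 1"
        using that by (simp add: power2_eq_square)
      then show "\<bar>(M (u a) $ i $ k * M (u a) $ j $ l / (norm (u a))\<^sup>2) * Y a $ k $ l\<bar> \<le> \<bar>Y a $ k $ l\<bar>"
        unfolding abs_mult by (intro mult_left_le_one_le) auto
    qed
    finally show ?thesis .
  qed
  have Z0: "(Z \<longlongrightarrow> 0) F"
  proof (intro vec_tendstoI)
    fix i j
    have "\<forall>\<^sub>F a in F. norm (Z a $ i $ j) \<le> (\<Sum>l\<in>UNIV. \<Sum>k\<in>UNIV. \<bar>Y a $ k $ l\<bar>)"
      using u by eventually_elim (simp add: bound)
    from Lim_null_comparison[OF this Ykl] show "((\<lambda>a. Z a $ i $ j) \<longlongrightarrow> 0 $ i $ j) F" by simp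
  qed
  have "M (u a) ** X a ** matrix_inv (M (u a)) = Z a + c *\<^sub>R mat 1" if "u a \<noteq> 0" for a
  proof -
    have "X a = Y a + c *\<^sub>R mat 1" by (simp add: Y_def)
    then show ?thesis
      by (simp add: Z_def matrix_add_ldistrib matrix_add_rdistrib matrix_mult_scaleR
          matrix_inv_mult invertible_M that)
  qed
  with u have "\<forall>\<^sub>F a in F. Z a + c *\<^sub>R mat 1 = M (u a) ** X a ** matrix_inv (M (u a))"
    by (auto elim!: eventually_mono)
  moreover have "((\<lambda>a. Z a + c *\<^sub>R mat 1) \<longlongrightarrow> c *\<^sub>R mat 1) F"
    using tendsto_add[OF Z0 tendsto_const] by simp
  ultimately show ?thesis by (rule Lim_transform_eventually[rotated])
qed

end

section \<open>Deleting a homogeneous coordinate\<close>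

text \<open>The value of a strictly monotone map at \<open>x\<close> is the element of the range with as many
  predecessors in the range as \<open>x\<close> has.\<close>

lemma strict_mono_eq_if_range_eq:
  fixes f g :: "'n::{finite,linorder} \<Rightarrow> 'm::{finite,linorder}"
  assumes f: "strict_mono f" and g: "strict_mono g" and R: "range f = range g"
  shows "f = g"
proof
  have card: "card {y \<in> range h. y < h x} = card {..<x}"
    if "strict_mono h" for h :: "'n \<Rightarrow> 'm" and x
  proof -
    have "{y \<in> range h. y < h x} = h ` {..<x}"
      using that by (auto simp: strict_mono_less)
    then show ?thesis
      using that by (metis card_image inj_on_subset strict_mono_imp_inj_on subset_UNIV)
  qed
  have le: "\<not> h x < k x" if "strict_mono h" "strict_mono k" "range h = range k"
    for h k :: "'n \<Rightarrow> 'm" and x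
  proof
    assume "h x < k x"
    then have "{y \<in> range h. y < h x} \<subseteq> {y \<in> range h. y < k x}" by auto
    moreover have "h x \<in> {y \<in> range h. y < k x} - {y \<in> range h. y < h x}"
      using \<open>h x < k x\<close> by simp
    ultimately have "{y \<in> range h. y < h x} \<subset> {y \<in> range h. y < k x}" by blast
    then have "card {y \<in> range h. y < h x} < card {y \<in> range h. y < k x}"
      by (intro psubset_card_mono) auto
    then show False
      using card[OF that(1), of x] card[OF that(2), of x] unfolding that(3) by linarith
  qed
  show "f x = g x" for x
    using le[OF f g R, of x] le[OF g f R[symmetric], of x] by simp
qed

text \<open>No index separates \<open>i\<close> from \<open>j\<close>, so replacing \<open>j\<close> by \<open>i\<close> in the increasing enumeration of the
  complement of \<open>i\<close> leaves it increasing.\<close>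

lemma deletion_index_adjacent:
  fixes i j :: "'m::{finite,linorder}"
  assumes "CARD('m) = CARD('n::{finite,linorder}) + 1"
    and "i < j" and adj: "\<not> (\<exists>k. i < k \<and> k < j)"
  shows "(deletion_index j :: 'n \<Rightarrow> 'm) = Transposition.transpose i j \<circ> deletion_index i"
proof (rule strict_mono_eq_if_range_eq)
  note di = deletion_index[where 'm = 'm and 'n = 'n, OF assms(1)]
  show "strict_mono (deletion_index j :: 'n \<Rightarrow> 'm)" by (rule di)
  show "strict_mono (Transposition.transpose i j \<circ> (deletion_index i :: 'n \<Rightarrow> 'm))"
  proof (rule strict_monoI)
    fix x y :: 'n assume "x < y"
    then have "(deletion_index i x :: 'm) < deletion_index i y"
      using di(1)[of i] by (simp add: strict_mono_less)
    moreover have "(deletion_index i x :: 'm) \<noteq> i" "(deletion_index i y :: 'm) \<noteq> i"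
      using di(2)[of i] by auto
    ultimately show "(Transposition.transpose i j \<circ> deletion_index i) x < (Transposition.transpose i j \<circ> deletion_index i) y"
      using \<open>i < j\<close> adj unfolding comp_def Transposition.transpose_def
      by (smt (verit, best) linorder_less_linear order_less_trans)
  qed
  have "range (Transposition.transpose i j \<circ> (deletion_index i :: 'n \<Rightarrow> 'm)) = Transposition.transpose i j ` (- {i})"
    unfolding image_comp[symmetric] di(2) ..
  also have "\<dots> = - {j}"
    by (simp add: bij_image_Compl_eq)
  finally show "range (deletion_index j :: 'n \<Rightarrow> 'm) = range (Transposition.transpose i j \<circ> (deletion_index i :: 'n \<Rightarrow> 'm))"
    by (simp add: di(2))
qed

context composition_algebra
begin

definition deleted_vector :: "'m \<Rightarrow> real^'m::{finite,linorder} \<Rightarrow> 'a" where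
  "deleted_vector i a = (\<Sum>r\<in>UNIV. (a $ deletion_index i r) *\<^sub>R e r)"

lemma linear_deleted_vector: "linear (deleted_vector i)"
  by (rule linearI) (simp_all add: deleted_vector_def scaleR_add_left sum.distrib scaleR_sum_right)

lemma deleted_vector_scaleR: "deleted_vector i (c *\<^sub>R a) = c *\<^sub>R deleted_vector i a"
  by (rule linear_cmul[OF linear_deleted_vector])

lemma inner_deleted_vector: "deleted_vector i a \<bullet> e r = a $ deletion_index i r"
  by (simp add: deleted_vector_def inner_sum_left inner_basis if_distrib cong: if_cong)

lemma norm_deleted_vector:
  fixes a :: "real^'m::{finite,linorder}"
  assumes "CARD('m) = CARD('n) + 1"
  shows "(norm (deleted_vector i a))\<^sup>2 = (norm a)\<^sup>2 - (a $ i)\<^sup>2"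
proof -
  note di = deletion_index[where 'm = 'm and 'n = 'n, OF assms, of i]
  have "(norm (deleted_vector i a))\<^sup>2 = (\<Sum>r\<in>(UNIV :: 'n set). (a $ deletion_index i r)\<^sup>2)"
    unfolding power2_norm_eq_inner
    by (subst inner_expansion) (simp add: inner_deleted_vector power2_eq_square)
  also have "\<dots> = (\<Sum>k\<in>- {i}. (a $ k)\<^sup>2)"
    unfolding di(2)[symmetric] using strict_mono_imp_inj_on[OF di(1)] by (simp add: sum.reindex)
  also have "\<dots> = (\<Sum>k\<in>UNIV. (a $ k)\<^sup>2) - (a $ i)\<^sup>2"
    by (simp add: Compl_eq_Diff_UNIV sum_diff1)
  also have "(\<Sum>k\<in>UNIV. (a $ k)\<^sup>2) = (norm a)\<^sup>2"
    unfolding power2_norm_eq_inner by (simp add: inner_vec_def power2_eq_square)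
  finally show ?thesis .
qed

lemma deleted_vector_eq_0_iff:
  fixes a :: "real^'m::{finite,linorder}"
  assumes "CARD('m) = CARD('n) + 1"
  shows "deleted_vector i a = 0 \<longleftrightarrow> a = axis i (a $ i)"
proof
  assume "deleted_vector i a = 0"
  then have 0: "a $ deletion_index i r = 0" for r :: 'n
    by (metis inner_deleted_vector inner_zero_left)
  have "a $ k = axis i (a $ i) $ k" for k
  proof (cases "k = i")
    case False
    then obtain r :: 'n where "k = deletion_index i r"
      using deletion_index(2)[where 'm = 'm and 'n = 'n, OF assms, of i] by blast
    with 0 False show ?thesis by (simp add: axis_def)
  qed (simp add: axis_def)
  then show "a = axis i (a $ i)" unfolding vec_eq_iff by blast
next
  assume "a = axis i (a $ i)"
  then have "a \<bullet> a = a $ i * a $ i" by (metis inner_axis inner_real_def)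
  then have "(norm (deleted_vector i a))\<^sup>2 = 0"
    unfolding norm_deleted_vector[OF assms] by (simp add: power2_norm_eq_inner power2_eq_square[of "a $ i"])
  then show "deleted_vector i a = 0" by simp
qed

text \<open>For adjacent indices the two deletions differ in one slot \<open>s\<close> only, which holds the \<open>j\<close>-th coordinate
  in the first and the \<open>i\<close>-th in the second. Without adjacency several slots would be permuted.\<close>

lemma deleted_vector_adjacent:
  fixes i j :: "'m::{finite,linorder}"
  assumes card: "CARD('m) = CARD('n) + 1" and "i < j" "\<not> (\<exists>k. i < k \<and> k < j)"
  obtains s where "\<And>a. deleted_vector i a \<bullet> e s = a $ j"
    and "\<And>a. deleted_vector j a = deleted_vector i a + (a $ i - a $ j) *\<^sub>R e s"
proof -
  note di = deletion_index[where 'm = 'm and 'n = 'n, OF card, of i]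
  obtain s :: 'n where s: "deletion_index i s = j"
  proof -
    have "j \<in> range (deletion_index i :: 'n \<Rightarrow> 'm)" unfolding di(2) using \<open>i < j\<close> by simp
    then show ?thesis using that by (auto simp: image_iff)
  qed
  have idx: "deletion_index j r = (if r = s then i else deletion_index i r)" for r :: 'n
  proof -
    have "deletion_index i r \<noteq> i" using di(2) by auto
    moreover have "deletion_index i r = j \<longleftrightarrow> r = s"
      using strict_mono_imp_inj_on[OF di(1)] s by (metis injD)
    ultimately show ?thesis
      using deletion_index_adjacent[OF assms] by (auto simp: Transposition.transpose_def)
  qed
  have "deleted_vector j a = deleted_vector i a + (a $ i - a $ j) *\<^sub>R e s" for a
  proof -
    have "deleted_vector j a - deleted_vector i a = (\<Sum>r\<in>UNIV. if r = s then (a $ i - a $ j) *\<^sub>R e r else 0)"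
      unfolding deleted_vector_def sum_subtractf[symmetric]
      by (intro sum.cong) (auto simp: idx s scaleR_diff_left)
    then show ?thesis by (simp add: algebra_simps)
  qed
  then show thesis using that[of s] by (simp add: inner_deleted_vector s)
qed

section \<open>Pairing adjacent coordinate axes\<close>

definition off_axes :: "'m::{finite,linorder} set \<Rightarrow> (real^'m::{finite,linorder}) set" where
  "off_axes A = {a. a \<noteq> 0 \<and> (\<forall>i\<in>A. deleted_vector i a \<noteq> 0)}"

text \<open>Near the \<open>i\<close>-th axis, in the affine chart where the \<open>i\<close>-th coordinate is 1, the matrix \<open>B\<close> may
  degenerate only in the way \<open>M (deleted_vector i a)\<close> does.\<close>

definition tame_at ::
  "'m::{finite,linorder} \<Rightarrow> (real^'m::{finite,linorder} \<Rightarrow> real^'n::{finite,linorder}^'n::{finite,linorder}) \<Rightarrow> bool" where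
  "tame_at i B \<longleftrightarrow> (\<exists>K. invertible K \<and>
     ((\<lambda>a. B a ** matrix_inv (M (deleted_vector i a))) \<longlongrightarrow> K) (at (axis i 1) within {a. a $ i = 1}))"

text \<open>The even factors. The condition on the axes outside \<open>A\<close> makes such functions compatible with
  multiplication: the value there is scalar, hence commutes in the limit with a factor that
  degenerates on one of these axes.\<close>

definition clutching ::
  "'m::{finite,linorder} set \<Rightarrow> (real^'m::{finite,linorder} \<Rightarrow> real^'n::{finite,linorder}^'n::{finite,linorder}) \<Rightarrow> bool" where
  "clutching A B \<longleftrightarrow>
     (\<forall>t a. t \<noteq> 0 \<longrightarrow> B (t *\<^sub>R a) = B a) \<and>
     continuous_on (off_axes A) B \<and>
     (\<forall>a \<in> off_axes A. invertible (B a)) \<and>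
     (\<forall>i. i \<notin> A \<longrightarrow> (\<exists>c. c \<noteq> 0 \<and> B (axis i 1) = c *\<^sub>R mat 1)) \<and>
     (\<forall>i\<in>A. tame_at i B)"

lemma continuous_on_deleted_vector: "continuous_on S (deleted_vector i)"
  using linear_deleted_vector[of i] by (simp add: linear_continuous_on linear_conv_bounded_linear)

lemma continuous_on_M: "continuous_on S f \<Longrightarrow> continuous_on S (\<lambda>x. M (f x))"
  using bounded_linear.continuous_on[OF linear_M[unfolded linear_conv_bounded_linear]] .

lemma clutchingD:
  assumes "clutching A B"
  shows "t \<noteq> 0 \<Longrightarrow> B (t *\<^sub>R a) = B a"
    and "continuous_on (off_axes A) B"
    and "a \<in> off_axes A \<Longrightarrow> invertible (B a)"
    and "i \<notin> A \<Longrightarrow> \<exists>c. c \<noteq> 0 \<and> B (axis i 1) = c *\<^sub>R mat 1"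
    and "i \<in> A \<Longrightarrow> tame_at i B"
  using assms by (simp_all add: clutching_def)

lemma open_off_axes: "open (off_axes A)"
proof -
  have "off_axes A = - {0} \<inter> (\<Inter>i\<in>A. deleted_vector i -` (- {0}))"
    by (auto simp: off_axes_def)
  moreover have "open (deleted_vector i -` (- {0}) :: (real, 'm) vec set)" for i :: "'m::{finite,linorder}"
    by (intro open_vimage continuous_on_deleted_vector) auto
  ultimately show ?thesis by (auto intro!: open_Int open_INT)
qed

lemma axis_in_off_axes:
  fixes A :: "'m::{finite,linorder} set"
  assumes "CARD('m) = CARD('n) + 1" "i \<notin> A"
  shows "axis i 1 \<in> off_axes A"
proof -
  have "deleted_vector k (axis i 1) \<noteq> 0" if "k \<noteq> i" for k
  proof -
    have "(norm (deleted_vector k (axis i 1)))\<^sup>2 = 1"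
      unfolding norm_deleted_vector[OF assms(1)] using that
        by (simp add: power2_norm_eq_inner inner_axis_axis) (simp add: axis_def)
    then show ?thesis by auto
  qed
  then show ?thesis using assms(2) by (simp add: off_axes_def axis_eq_0_iff) metis
qed

lemma eventually_deleted_vector_nonzero:
  fixes i :: "'m::{finite,linorder}"
  assumes "CARD('m) = CARD('n) + 1"
  shows "\<forall>\<^sub>F a in at (axis i 1) within {a. a $ i = 1}. deleted_vector i a \<noteq> 0"
  unfolding eventually_at_filter
  by (rule always_eventually) (metis (mono_tags) assms deleted_vector_eq_0_iff mem_Collect_eq)

lemma clutching_tendsto:
  fixes A :: "'m::{finite,linorder} set"
  assumes "clutching A B" "CARD('m) = CARD('n) + 1" "i \<notin> A"
  shows "(B \<longlongrightarrow> B (axis i 1)) (at (axis i 1) within S)"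
proof -
  have "isCont B (axis i 1)"
    using assms(1) axis_in_off_axes[OF assms(2,3)] continuous_on_eq_continuous_at[OF open_off_axes]
    by (auto simp: clutching_def)
  then show ?thesis
    unfolding isCont_def by (rule tendsto_within_subset) simp
qed

lemma clutching_empty: "clutching {} (\<lambda>_. mat 1)"
  by (auto simp: clutching_def invertible_def matrix_mul_lid intro: exI[of _ 1])

text \<open>With \<open>i\<close>, \<open>j\<close> adjacent and \<open>s\<close> the slot in which their deletions differ, this is the quadratic map
  vanishing to first order on exactly the two axes: its slot \<open>s\<close> holds
  \<open>a\<^sub>i a\<^sub>j - (\<Sum>k. a\<^sub>k\<^sup>2)\<close>, summed over the remaining indices \<open>k\<close>, and the other slots hold
  \<open>(a\<^sub>i + a\<^sub>j) a\<^sub>k\<close>.\<close>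

definition pair_vector ::
  "'m::{finite,linorder} \<Rightarrow> 'm \<Rightarrow> 'n \<Rightarrow> real^'m::{finite,linorder} \<Rightarrow> 'a" where
  "pair_vector i j s a =
     (a $ i + a $ j) *\<^sub>R deleted_vector i a - (norm (deleted_vector i a))\<^sup>2 *\<^sub>R e s"

text \<open>The constant left factor turns the value on the remaining axes, where the vector is a multiple of
  \<open>e s\<close>, into a scalar matrix; division by the squared norm makes the function homogeneous of
  degree 0.\<close>

definition pair_matrix ::
  "'m::{finite,linorder} \<Rightarrow> 'm \<Rightarrow> 'n \<Rightarrow> real^'m::{finite,linorder} \<Rightarrow> real^'n::{finite,linorder}^'n::{finite,linorder}" where
  "pair_matrix i j s a = (1 / (norm a)\<^sup>2) *\<^sub>R (transpose (M (e s)) ** M (pair_vector i j s a))"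

lemma norm_basis: "norm (e s) = 1"
  using inner_basis[of s s] by (simp add: norm_eq_sqrt_inner)

lemma invertible_transpose_basis: "invertible (transpose (M (e s)))"
proof -
  have "e s \<noteq> 0" using norm_basis[of s] by auto
  then show ?thesis by (simp add: invertible_M transpose_invertible)
qed

context
  fixes i j :: "'m::{finite,linorder}" and s :: 'n
  assumes card: "CARD('m) = CARD('n) + 1" and ij: "i \<noteq> j"
    and slot: "\<And>a. deleted_vector i a \<bullet> e s = a $ j"
    and swap: "\<And>a. deleted_vector j a = deleted_vector i a + (a $ i - a $ j) *\<^sub>R e s"
begin

lemma norm_deleted_vector_swap:
  "(norm (deleted_vector j a))\<^sup>2 = (norm (deleted_vector i a))\<^sup>2 + (a $ i)\<^sup>2 - (a $ j)\<^sup>2"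
  by (simp add: norm_deleted_vector[OF card])

text \<open>Passing from \<open>i\<close> to \<open>j\<close> changes both terms by the same multiple
  \<open>(a\<^sub>i + a\<^sub>j) (a\<^sub>i - a\<^sub>j) = a\<^sub>i\<^sup>2 - a\<^sub>j\<^sup>2\<close> of \<open>e s\<close>.\<close>

lemma pair_vector_swap:
  "pair_vector i j s a = (a $ i + a $ j) *\<^sub>R deleted_vector j a - (norm (deleted_vector j a))\<^sup>2 *\<^sub>R e s"
proof -
  have "(norm (deleted_vector j a))\<^sup>2 *\<^sub>R e s =
      (norm (deleted_vector i a))\<^sup>2 *\<^sub>R e s + ((a $ i + a $ j) * (a $ i - a $ j)) *\<^sub>R e s"
    unfolding norm_deleted_vector_swap scaleR_add_left[symmetric]
    by (simp add: power2_eq_square algebra_simps)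
  then show ?thesis
    by (simp add: pair_vector_def swap scaleR_add_right)
qed

text \<open>Since each factor on the right vanishes on one axis only, this locates the zeros of the vector.\<close>

lemma norm_pair_vector:
  "(norm (pair_vector i j s a))\<^sup>2 = (norm (deleted_vector i a))\<^sup>2 * (norm (deleted_vector j a))\<^sup>2"
proof -
  let ?u = "deleted_vector i a"
  have diff: "(norm (x - y))\<^sup>2 = (norm x)\<^sup>2 - 2 * (x \<bullet> y) + (norm y)\<^sup>2" for x y :: 'a
    unfolding power2_norm_eq_inner inner_diff_left inner_diff_right by (simp add: inner_commute)
  have "(norm (pair_vector i j s a))\<^sup>2 =
      (a $ i + a $ j)\<^sup>2 * (norm ?u)\<^sup>2 - 2 * (a $ i + a $ j) * (norm ?u)\<^sup>2 * a $ j + ((norm ?u)\<^sup>2)\<^sup>2"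
    unfolding pair_vector_def diff by (simp add: power_mult_distrib norm_basis slot)
  also have "\<dots> = (norm ?u)\<^sup>2 * ((norm ?u)\<^sup>2 + (a $ i)\<^sup>2 - (a $ j)\<^sup>2)"
    by algebra
  finally show ?thesis unfolding norm_deleted_vector_swap .
qed

lemma continuous_on_pair_matrix: "continuous_on (- {0}) (pair_matrix i j s)"
  unfolding pair_matrix_def pair_vector_def
  by (intro continuous_intros continuous_on_M continuous_on_deleted_vector) auto

lemma invertible_pair_matrix:
  assumes "deleted_vector i a \<noteq> 0" "deleted_vector j a \<noteq> 0"
  shows "invertible (pair_matrix i j s a)"
proof -
  have "(norm (pair_vector i j s a))\<^sup>2 \<noteq> 0"
    using assms by (simp add: norm_pair_vector)
  then have "pair_vector i j s a \<noteq> 0" by auto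
  moreover have "a \<noteq> 0" using assms by (auto simp: deleted_vector_def)
  ultimately show ?thesis
    unfolding pair_matrix_def
    by (intro invertible_scaleR invertible_mult invertible_transpose_basis invertible_M) auto
qed

lemma pair_matrix_scaleR:
  assumes "t \<noteq> 0"
  shows "pair_matrix i j s (t *\<^sub>R a) = pair_matrix i j s a"
proof -
  have "pair_vector i j s (t *\<^sub>R a) = t\<^sup>2 *\<^sub>R pair_vector i j s a"
  proof -
    have "(t *\<^sub>R a) $ i + (t *\<^sub>R a) $ j = t * (a $ i + a $ j)" by (simp add: distrib_left)
    then show ?thesis
      unfolding pair_vector_def deleted_vector_scaleR norm_scaleR power_mult_distrib scaleR_diff_right
      by (simp add: power2_eq_square mult_ac)
  qed
  then show ?thesis
    using assms by (simp add: pair_matrix_def linear_cmul[OF linear_M] matrix_mult_scaleR power_mult_distrib)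
qed

lemma pair_matrix_axis:
  assumes "k \<noteq> i" "k \<noteq> j"
  shows "pair_matrix i j s (axis k 1) = - mat 1"
proof -
  have 0: "axis k (1::real) $ i = 0" "axis k (1::real) $ j = 0" using assms by (auto simp: axis_def)
  then have "(norm (deleted_vector i (axis k 1)))\<^sup>2 = 1"
    by (simp add: norm_deleted_vector[OF card])
  then have "pair_vector i j s (axis k 1) = - e s"
    by (simp add: pair_vector_def 0)
  then show ?thesis
    unfolding pair_matrix_def
    using matrix_mult_scaleR(2)[of "transpose (M (e s))" "- 1" "M (e s)"]
    by (simp add: linear_neg[OF linear_M] transpose_M_mult norm_basis)
qed

text \<open>With \<open>u = deleted_vector k a\<close>, the quotient of \<open>M (pair_vector i j s a)\<close> by \<open>M u\<close> is
  \<open>(a\<^sub>i + a\<^sub>j) I - M (e s) (M u)\<^sup>T\<close>, because \<open>norm u ^ 2\<close> cancels against the inverse of \<open>M u\<close>; at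
  the axis \<open>u\<close> is 0 and \<open>a\<^sub>i + a\<^sub>j\<close> is 1.\<close>

lemma tame_at_pair_matrix:
  assumes k: "k = i \<or> k = j"
  shows "tame_at k (pair_matrix i j s)"
proof -
  let ?F = "at (axis k 1) within {a. a $ k = 1}"
  let ?u = "deleted_vector k"
  let ?T = "transpose (M (e s))"
  let ?h = "\<lambda>a. (1 / (norm a)\<^sup>2) *\<^sub>R (?T ** ((a $ i + a $ j) *\<^sub>R mat 1 - M (e s) ** transpose (M (?u a))))"
  have pv: "pair_vector i j s a = (a $ i + a $ j) *\<^sub>R ?u a - (norm (?u a))\<^sup>2 *\<^sub>R e s" for a
    using k pair_vector_swap by (auto simp: pair_vector_def)
  have eq: "pair_matrix i j s a ** matrix_inv (M (?u a)) = ?h a" if "?u a \<noteq> 0" for a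
  proof -
    have "M (pair_vector i j s a) ** matrix_inv (M (?u a)) =
        ((a $ i + a $ j) *\<^sub>R M (?u a) - (norm (?u a))\<^sup>2 *\<^sub>R M (e s)) ** matrix_inv (M (?u a))"
      by (simp add: pv linear_diff[OF linear_M] linear_cmul[OF linear_M])
    also have "\<dots> = (a $ i + a $ j) *\<^sub>R mat 1 - M (e s) ** transpose (M (?u a))"
      using that by (simp add: matrix_diff_rdistrib matrix_mult_scaleR matrix_inv_mult invertible_M)
        (simp add: matrix_mult_scaleR matrix_inv_M)
    finally show ?thesis
      by (simp add: pair_matrix_def matrix_mult_scaleR flip: matrix_mul_assoc)
  qed
  have ev: "\<forall>\<^sub>F a in ?F. ?h a = pair_matrix i j s a ** matrix_inv (M (?u a))"
    using eventually_deleted_vector_nonzero[OF card] by eventually_elim (simp add: eq)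
  have "(?h \<longlongrightarrow> ?T) ?F"
  proof -
    have "((\<lambda>a. M (?u a)) \<longlongrightarrow> M (?u (axis k 1))) ?F"
      using linear_compose[OF linear_deleted_vector linear_M, of k]
      by (intro isCont_tendsto_compose[where g = "\<lambda>a. M (?u a)", OF _ tendsto_ident_at])
        (simp add: o_def linear_linear linear_continuous_at)
    moreover have "?u (axis k 1) = 0" unfolding deleted_vector_eq_0_iff[OF card] by simp
    ultimately have "((\<lambda>a. M (?u a)) \<longlongrightarrow> 0) ?F" by (simp add: linear_0[OF linear_M])
    then have "(?h \<longlongrightarrow> (1 / (norm (axis k (1::real)))\<^sup>2) *\<^sub>R (?T ** ((axis k 1 $ i + axis k 1 $ j) *\<^sub>R mat 1 - M (e s) ** transpose 0))) ?F"
      by (intro tendsto_intros) auto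
    moreover have "axis k 1 $ i + axis k 1 $ j = (1::real)" using k ij by (auto simp: axis_def)
    moreover have "M (e s) ** transpose (0 :: ((real, 'n) vec, 'n) vec) = 0"
      by (simp add: vec_eq_iff matrix_matrix_mult_def transpose_def)
    ultimately show ?thesis by simp
  qed
  then have "((\<lambda>a. pair_matrix i j s a ** matrix_inv (M (?u a))) \<longlongrightarrow> ?T) ?F"
    using ev by (rule Lim_transform_eventually)
  then show ?thesis
    unfolding tame_at_def using invertible_transpose_basis by blast
qed

text \<open>At an axis in \<open>A\<close> the new factor is the scalar -1 and \<open>B\<close> is tame. At the two new axes the new
  factor is tame and \<open>B\<close>, being scalar in the limit, is moved to its left by conjugation.\<close>

lemma clutching_insert_pair:
  assumes B: "clutching A B" and "i \<notin> A" "j \<notin> A"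
  shows "clutching (insert i (insert j A)) (\<lambda>a. pair_matrix i j s a ** B a)"
    (is "clutching ?A ?B")
  unfolding clutching_def
proof (intro conjI allI impI ballI)
  have sub: "off_axes ?A \<subseteq> off_axes A" "off_axes ?A \<subseteq> - {0}" by (auto simp: off_axes_def)
  show "?B (t *\<^sub>R a) = ?B a" if "t \<noteq> 0" for t a
    using that by (simp add: clutchingD(1)[OF B] pair_matrix_scaleR)
  show "continuous_on (off_axes ?A) ?B"
    using continuous_on_subset[OF clutchingD(2)[OF B] sub(1)]
      continuous_on_subset[OF continuous_on_pair_matrix sub(2)]
    by (rule continuous_on_matrix_mult[rotated])
  show "invertible (?B a)" if "a \<in> off_axes ?A" for a
    using that sub(1) clutchingD(3)[OF B]
    by (intro invertible_mult invertible_pair_matrix) (auto simp: off_axes_def)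
  show "\<exists>c. c \<noteq> 0 \<and> ?B (axis k 1) = c *\<^sub>R mat 1" if "k \<notin> ?A" for k
  proof -
    have "k \<notin> A" using that by simp
    from clutchingD(4)[OF B this] obtain c where "c \<noteq> 0" "B (axis k 1) = c *\<^sub>R mat 1"
      by (elim exE conjE)
    with that show ?thesis
      by (intro exI[of _ "- c"]) (simp add: pair_matrix_axis matrix_mult_scaleR flip: scaleR_minus_left)
  qed
  show "tame_at k ?B" if "k \<in> ?A" for k
  proof (cases "k \<in> A")
    case True
    let ?F = "at (axis k 1) within {a. a $ k = 1}"
    obtain K where K: "invertible K"
      "((\<lambda>a. B a ** matrix_inv (M (deleted_vector k a))) \<longlongrightarrow> K) ?F"
      using clutchingD(5)[OF B True] unfolding tame_at_def by blast
    have k: "k \<noteq> i" "k \<noteq> j" using True assms by auto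
    have "isCont (pair_matrix i j s) (axis k 1)"
      using continuous_on_pair_matrix continuous_on_eq_continuous_at[OF open_Compl[OF closed_singleton]]
      by (metis ComplI axis_eq_0_iff singletonD zero_neq_one)
    then have "(pair_matrix i j s \<longlongrightarrow> (- 1) *\<^sub>R mat 1) ?F"
      unfolding isCont_def pair_matrix_axis[OF k] scaleR_minus1_left by (rule tendsto_within_subset) simp
    from tendsto_matrix_mult[OF this K(2)]
    have "((\<lambda>a. pair_matrix i j s a ** B a ** matrix_inv (M (deleted_vector k a))) \<longlongrightarrow> (- 1) *\<^sub>R K) ?F"
      unfolding matrix_mul_assoc matrix_mult_scaleR matrix_mul_lid .
    moreover have "invertible ((- 1) *\<^sub>R K)" by (rule invertible_scaleR[OF K(1)]) simp
    ultimately show ?thesis unfolding tame_at_def by (intro exI conjI)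
  next
    case False
    with that have k: "k = i \<or> k = j" by auto
    let ?F = "at (axis k 1) within {a. a $ k = 1}"
    let ?I = "\<lambda>a. matrix_inv (M (deleted_vector k a))"
    obtain K where K: "invertible K" "((\<lambda>a. pair_matrix i j s a ** ?I a) \<longlongrightarrow> K) ?F"
      using tame_at_pair_matrix[OF k] unfolding tame_at_def by blast
    from clutchingD(4)[OF B False] obtain c where c: "c \<noteq> 0" "B (axis k 1) = c *\<^sub>R mat 1"
      by (elim exE conjE)
    have "((\<lambda>a. M (deleted_vector k a) ** B a ** ?I a) \<longlongrightarrow> c *\<^sub>R mat 1) ?F"
      using clutching_tendsto[OF B card False] unfolding c(2)
      by (rule tendsto_conjugate_scalar) (rule eventually_deleted_vector_nonzero[OF card])
    from tendsto_matrix_mult[OF K(2) this]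
    have lim: "((\<lambda>a. pair_matrix i j s a ** ?I a ** (M (deleted_vector k a) ** B a ** ?I a)) \<longlongrightarrow> c *\<^sub>R K) ?F"
      by (simp add: matrix_mult_scaleR)
    have "?B a ** ?I a = pair_matrix i j s a ** ?I a ** (M (deleted_vector k a) ** B a ** ?I a)"
      if "deleted_vector k a \<noteq> 0" for a
    proof -
      have "pair_matrix i j s a ** ?I a ** (M (deleted_vector k a) ** B a ** ?I a) =
          pair_matrix i j s a ** (?I a ** M (deleted_vector k a)) ** B a ** ?I a"
        by (simp only: matrix_mul_assoc)
      then show ?thesis by (simp add: matrix_inv_mult invertible_M that)
    qed
    then have "\<forall>\<^sub>F a in ?F. pair_matrix i j s a ** ?I a ** (M (deleted_vector k a) ** B a ** ?I a) = ?B a ** ?I a"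
      using eventually_deleted_vector_nonzero[OF card, of k] by (auto elim!: eventually_mono)
    with lim have "((\<lambda>a. ?B a ** ?I a) \<longlongrightarrow> c *\<^sub>R K) ?F"
      by (rule Lim_transform_eventually)
    then show ?thesis unfolding tame_at_def using invertible_scaleR[OF K(1) c(1)] by (intro exI[of _ "c *\<^sub>R K"] conjI)
  qed
qed

end

text \<open>The two largest elements of a lower set are adjacent; split them off and induct.\<close>

lemma ex_clutching_lower_set:
  fixes A :: "'m::{finite,linorder} set"
  assumes card: "CARD('m) = CARD('n) + 1"
  shows "even (card A) \<Longrightarrow> (\<And>x y. x \<in> A \<Longrightarrow> y < x \<Longrightarrow> y \<in> A) \<Longrightarrow> \<exists>B. clutching A B"
proof (induction "card A" arbitrary: A rule: less_induct)
  case less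
  show ?case
  proof (cases "A = {}")
    case True
    then show ?thesis using clutching_empty by auto
  next
    case False
    define j where "j = Max A"
    have j: "j \<in> A" "\<And>x. x \<in> A \<Longrightarrow> x \<le> j" using False by (auto simp: j_def)
    \<comment> \<open>Evenness of the cardinality excludes a single leftover axis.\<close>
    have "A - {j} \<noteq> {}"
    proof
      assume "A - {j} = {}"
      then have "A = {j}" using j by blast
      with less.prems show False by simp
    qed
    define i where "i = Max (A - {j})"
    have "i \<in> A - {j}" unfolding i_def by (rule Max_in) (use \<open>A - {j} \<noteq> {}\<close> in auto)
    moreover have i_max: "x \<le> i" if "x \<in> A - {j}" for x using that by (auto simp: i_def)
    ultimately have i: "i \<in> A" "i < j" using j(2) by (auto simp: order_less_le)
    have adj: "\<not> (\<exists>k. i < k \<and> k < j)"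
      using i_max less.prems(2) j(1) by (metis DiffI leD order_less_irrefl singletonD)
    define A' where "A' = A - {i, j}"
    have A: "A = insert i (insert j A')" "i \<notin> A'" "j \<notin> A'" using i j by (auto simp: A'_def)
    have "card A = card A' + 2" using A i by simp
    moreover have "y \<in> A'" if "x \<in> A'" "y < x" for x y
      using that less.prems(2) i_max j(2) unfolding A'_def by (auto simp: not_less) force+
    ultimately have "\<exists>B. clutching A' B" using less by auto
    then obtain B where B: "clutching A' B" ..
    obtain s where s: "\<And>a. deleted_vector i a \<bullet> e s = a $ j"
      "\<And>a. deleted_vector j a = deleted_vector i a + (a $ i - a $ j) *\<^sub>R e s"
      using deleted_vector_adjacent[OF card i(2) adj] by metis
    show ?thesis
      using clutching_insert_pair[OF card _ s B A(2,3)] i(2) A(1) by auto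
  qed
qed

section \<open>The odd frame\<close>

lemma off_axes_chart:
  fixes a :: "real^'m::{finite,linorder}"
  assumes card: "CARD('m) = CARD('n) + 1" and a: "a $ i = 1" "deleted_vector i a \<noteq> 0"
  shows "a \<in> off_axes UNIV"
proof -
  have "deleted_vector k a \<noteq> 0" for k
  proof
    assume 0: "deleted_vector k a = 0"
    then have "a = axis k (a $ k)" unfolding deleted_vector_eq_0_iff[OF card] .
    then have "a $ i = axis k (a $ k) $ i" by metis
    then have "k = i" using a(1) by (auto simp: axis_def split: if_splits)
    with 0 a(2) show False by simp
  qed
  moreover have "a \<noteq> 0" using a(1) by auto
  ultimately show ?thesis by (simp add: off_axes_def)
qed

lemma continuous_on_tame_extension:
  fixes G :: "real^'m::{finite,linorder} \<Rightarrow> real^'n::{finite,linorder}^'n::{finite,linorder}"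
  assumes card: "CARD('m) = CARD('n) + 1" and G: "continuous_on (off_axes UNIV) G"
    and K: "((\<lambda>a. G a ** matrix_inv (M (deleted_vector i a))) \<longlongrightarrow> K) (at (axis i 1) within {a. a $ i = 1})"
  shows "continuous_on {a. a $ i = 1}
    (\<lambda>a. if deleted_vector i a = 0 then K else G a ** matrix_inv (M (deleted_vector i a)))"
    (is "continuous_on ?S ?H")
  unfolding continuous_on_def
proof
  let ?F = "\<lambda>a. G a ** matrix_inv (M (deleted_vector i a))"
  fix a assume a: "a \<in> ?S"
  show "(?H \<longlongrightarrow> ?H a) (at a within ?S)"
  proof (cases "deleted_vector i a = 0")
    case True
    then have "a = axis i (a $ i)" unfolding deleted_vector_eq_0_iff[OF card] .
    with a have "a = axis i 1" by auto
    have "\<forall>\<^sub>F b in at (axis i 1) within ?S. ?F b = ?H b"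
      using eventually_deleted_vector_nonzero[OF card] by eventually_elim simp
    with K have "(?H \<longlongrightarrow> K) (at (axis i 1) within ?S)" by (rule Lim_transform_eventually)
    with True \<open>a = axis i 1\<close> show ?thesis by simp
  next
    case False
    with a have off: "a \<in> off_axes UNIV" using off_axes_chart[OF card] by blast
    have "continuous_on (off_axes UNIV) ?F"
      by (intro continuous_on_matrix_mult continuous_on_matrix_inv G continuous_on_M
          continuous_on_deleted_vector invertible_M) (simp add: off_axes_def)
    then have "(?F \<longlongrightarrow> ?F a) (at a)"
      using off continuous_on_eq_continuous_at[OF open_off_axes] unfolding isCont_def by blast
    moreover have "\<forall>\<^sub>F b in at a. ?F b = ?H b"
      using eventually_at_in_open'[OF open_off_axes off] by eventually_elim (simp add: off_axes_def)
    ultimately have "(?H \<longlongrightarrow> ?F a) (at a)" by (rule Lim_transform_eventually)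
    then show ?thesis using False by (simp add: tendsto_within_subset[of _ _ a UNIV])
  qed
qed

text \<open>All axes but the last are treated in pairs by an even factor; left multiplication by the deletion of the
  last coordinate is odd and treats the remaining axis. The division by the squared norm makes the
  degree -1, so that \<open>G a\<close> times the point \<open>a\<close> is unchanged when \<open>a\<close> is rescaled.\<close>

lemma ex_odd_frame:
  assumes card: "CARD('m::{finite,linorder}) = CARD('n) + 1" and even: "even CARD('n)"
  shows "\<exists>(G :: real^'m::{finite,linorder} \<Rightarrow> real^'n::{finite,linorder}^'n::{finite,linorder}).
    (\<forall>t a. t \<noteq> 0 \<longrightarrow> G (t *\<^sub>R a) = (1 / t) *\<^sub>R G a) \<and>
    continuous_on (off_axes UNIV) G \<and>
    (\<forall>a \<in> off_axes UNIV. invertible (G a)) \<and>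
    (\<forall>i. tame_at i G)"
proof -
  define z where "z = Max (UNIV :: 'm set)"
  have z_max: "x \<le> z" for x by (simp add: z_def)
  have "\<exists>B. clutching (- {z}) B"
  proof (rule ex_clutching_lower_set[OF card])
    show "even (card (- {z}))" using card even by (simp add: Compl_eq_Diff_UNIV)
    show "y \<in> - {z}" if "x \<in> - {z}" "y < x" for x y using z_max[of x] that by auto
  qed
  then obtain B where B: "clutching (- {z}) B" ..
  define G where "G = (\<lambda>a. (1 / (norm a)\<^sup>2) *\<^sub>R (M (deleted_vector z a) ** B a))"
  have sub: "off_axes UNIV \<subseteq> off_axes (- {z})" by (auto simp: off_axes_def)
  have hom: "G (t *\<^sub>R a) = (1 / t) *\<^sub>R G a" if "t \<noteq> 0" for t a
  proof -
    have "(norm (t *\<^sub>R a))\<^sup>2 = t\<^sup>2 * (norm a)\<^sup>2" by (simp add: power_mult_distrib)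
    then show ?thesis
      using that by (simp add: G_def clutchingD(1)[OF B] deleted_vector_scaleR linear_cmul[OF linear_M]
          matrix_mult_scaleR del: norm_scaleR) (simp add: power2_eq_square)
  qed
  have cont: "continuous_on (off_axes UNIV) G"
    unfolding G_def
    by (intro continuous_intros continuous_on_M continuous_on_deleted_vector
        continuous_on_subset[OF clutchingD(2)[OF B] sub]) (auto simp: off_axes_def)
  have inv: "invertible (G a)" if "a \<in> off_axes UNIV" for a
    unfolding G_def using that sub clutchingD(3)[OF B]
    by (intro invertible_scaleR invertible_mult invertible_M) (auto simp: off_axes_def)
  have tame: "tame_at i G" for i
  proof -
    let ?F = "at (axis i (1::real)) within {a. a $ i = 1}"
    let ?I = "\<lambda>a. matrix_inv (M (deleted_vector i a))"
    have "\<exists>K. invertible K \<and> ((\<lambda>a. M (deleted_vector z a) ** B a ** ?I a) \<longlongrightarrow> K) ?F"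
    proof (cases "i = z")
      case True
      then have i: "i \<notin> - {z}" by simp
      from clutchingD(4)[OF B i] obtain c where c: "c \<noteq> 0" "B (axis i 1) = c *\<^sub>R mat 1"
        by (elim exE conjE)
      have "((\<lambda>a. M (deleted_vector i a) ** B a ** ?I a) \<longlongrightarrow> c *\<^sub>R mat 1) ?F"
        using clutching_tendsto[OF B card i] unfolding c(2)
        by (rule tendsto_conjugate_scalar) (rule eventually_deleted_vector_nonzero[OF card])
      then show ?thesis
        using c(1) True by (intro exI[of _ "c *\<^sub>R mat 1"] conjI invertible_scaleR) (simp_all add: invertible_def exI[of _ "mat 1"])
    next
      case False
      then have "i \<in> - {z}" by simp
      from clutchingD(5)[OF B this] obtain K where K: "invertible K" "((\<lambda>a. B a ** ?I a) \<longlongrightarrow> K) ?F"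
        unfolding tame_at_def by (elim exE conjE)
      have "axis i 1 \<in> off_axes {z}" using False by (intro axis_in_off_axes[OF card]) simp
      then have nz: "deleted_vector z (axis i 1) \<noteq> 0" by (simp add: off_axes_def)
      have "continuous_on UNIV (\<lambda>a. M (deleted_vector z a))"
        by (intro continuous_on_M continuous_on_deleted_vector)
      then have "((\<lambda>a. M (deleted_vector z a)) \<longlongrightarrow> M (deleted_vector z (axis i 1))) ?F"
        unfolding continuous_on_def by (auto intro: tendsto_within_subset)
      from tendsto_matrix_mult[OF this K(2)] show ?thesis
        unfolding matrix_mul_assoc using invertible_mult[OF invertible_M[OF nz] K(1)] by blast
    qed
    then obtain K where K: "invertible K" "((\<lambda>a. M (deleted_vector z a) ** B a ** ?I a) \<longlongrightarrow> K) ?F"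
      by (elim exE conjE)
    have "((\<lambda>a. 1 / (norm a)\<^sup>2) \<longlongrightarrow> 1 / (norm (axis i (1::real)))\<^sup>2) ?F"
      by (intro tendsto_divide tendsto_power tendsto_norm[OF tendsto_ident_at] tendsto_const) simp
    from tendsto_scaleR[OF this K(2)] have "((\<lambda>a. G a ** ?I a) \<longlongrightarrow> K) ?F"
      by (simp add: G_def matrix_mult_scaleR)
    with K(1) show ?thesis unfolding tame_at_def by blast
  qed
  from hom cont inv tame show ?thesis by blast
qed

end

section \<open>Recognising a glued bundle\<close>

text \<open>Local trivialisations of \<open>F\<close> are pulled back along \<open>\<phi>\<close>.\<close>

lemma vector_bundle_transport:
  fixes E :: "('e, 'b) vbundle" and F :: "('f, 'b) vbundle"
  assumes F: "vector_bundle TYPE('n::finite) F" and iso: "bundle_isomorphism E F \<phi>"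
    and base: "base_space E = base_space F"
    and scale: "\<And>x c. x \<in> topspace (tot_space E) \<Longrightarrow>
      vscale E c x \<in> topspace (tot_space E) \<and> bproj E (vscale E c x) = bproj E x"
    and add: "\<And>x y. x \<in> topspace (tot_space E) \<Longrightarrow> y \<in> topspace (tot_space E) \<Longrightarrow>
      bproj E x = bproj E y \<Longrightarrow>
      vadd E x y \<in> topspace (tot_space E) \<and> bproj E (vadd E x y) = bproj E x"
  shows "vector_bundle TYPE('n) E"
proof -
  have hom: "homeomorphic_map (tot_space E) (tot_space F) \<phi>"
    and proj: "\<And>x. x \<in> topspace (tot_space E) \<Longrightarrow> bproj F (\<phi> x) = bproj E x"
    and lin: "\<And>x c. x \<in> topspace (tot_space E) \<Longrightarrow> \<phi> (vscale E c x) = vscale F c (\<phi> x)"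
      "\<And>x y. x \<in> topspace (tot_space E) \<Longrightarrow> y \<in> topspace (tot_space E) \<Longrightarrow>
        bproj E y = bproj E x \<Longrightarrow> \<phi> (vadd E x y) = vadd F (\<phi> x) (\<phi> y)"
    using iso by (simp_all add: bundle_isomorphism_def)
  have cont: "continuous_map (tot_space E) (tot_space F) \<phi>"
    using hom by (rule homeomorphic_imp_continuous_map)
  have mem: "\<phi> x \<in> topspace (tot_space F)" if "x \<in> topspace (tot_space E)" for x
    using continuous_map_funspace[OF cont] that by blast
  have "continuous_map (tot_space E) (base_space E) (bproj F \<circ> \<phi>)"
    using F unfolding base vector_bundle_def by (intro continuous_map_compose[OF cont]) simp
  then have "continuous_map (tot_space E) (base_space E) (bproj E)"
    by (rule continuous_map_eq) (simp add: proj)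
  moreover have "\<exists>U (h :: 'e \<Rightarrow> 'b \<times> (real^'n)).
      openin (base_space E) U \<and> b \<in> U \<and> local_trivialization E U h"
    if "b \<in> topspace (base_space E)" for b
  proof -
    have "\<exists>U (h :: 'f \<Rightarrow> 'b \<times> (real^'n)). openin (base_space F) U \<and> b \<in> U \<and> local_trivialization F U h"
      using F that unfolding base vector_bundle_def by simp
    then obtain U and h :: "'f \<Rightarrow> 'b \<times> (real^'n)" where U: "openin (base_space F) U" "b \<in> U"
      and h: "local_trivialization F U h" by (elim exE conjE)
    have "homeomorphic_map (subtopology (tot_space E) {x. bproj E x \<in> U})
        (subtopology (tot_space F) {x. bproj F x \<in> U}) \<phi>"
    proof (rule homeomorphic_map_subtopologies[OF hom])
      show "\<phi> ` (topspace (tot_space E) \<inter> {x. bproj E x \<in> U}) = topspace (tot_space F) \<inter> {x. bproj F x \<in> U}"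
        unfolding homeomorphic_imp_surjective_map[OF hom, symmetric] using proj by auto
    qed
    then have "homeomorphic_map (subtopology (tot_space E) {x. bproj E x \<in> U})
        (prod_topology (subtopology (base_space E) U) euclidean) (h \<circ> \<phi>)"
      unfolding base by (rule homeomorphic_map_compose[OF _ h[unfolded local_trivialization_def, THEN conjunct1]])
    with h have "local_trivialization E U (h \<circ> \<phi>)"
      unfolding local_trivialization_def by (simp add: proj lin mem)
    with U show ?thesis unfolding base by (intro exI conjI)
  qed
  ultimately show ?thesis
    using scale add unfolding vector_bundle_def by simp
qed

lemma local_trivialization_inverse:
  fixes h :: "'e \<Rightarrow> 'b \<times> (real^'n)"
  assumes h: "local_trivialization F U h" and U: "openin (base_space F) U"
  shows "\<exists>k. continuous_map (prod_topology (subtopology (base_space F) U) euclidean) (tot_space F) k \<and>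
    open_map (prod_topology (subtopology (base_space F) U) euclidean)
      (subtopology (tot_space F) {x. bproj F x \<in> U}) k \<and>
    (\<forall>p w. p \<in> U \<longrightarrow> k (p, w) \<in> topspace (tot_space F) \<and> bproj F (k (p, w)) = p \<and> h (k (p, w)) = (p, w)) \<and>
    (\<forall>x \<in> topspace (tot_space F). bproj F x \<in> U \<longrightarrow> k (h x) = x)"
proof -
  let ?T = "subtopology (tot_space F) {x. bproj F x \<in> U}"
  let ?P = "prod_topology (subtopology (base_space F) U) (euclidean :: (real^'n) topology)"
  have sub: "U \<subseteq> topspace (base_space F)" using U by (rule openin_subset)
  have "homeomorphic_map ?T ?P h" using h by (simp add: local_trivialization_def)
  then obtain k where k: "homeomorphic_maps ?T ?P h k" by (auto simp: homeomorphic_map_maps)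
  have P: "(p, w) \<in> topspace ?P" if "p \<in> U" for p w using that sub by auto
  have cont: "continuous_map ?P ?T k" and hk: "\<And>y. y \<in> topspace ?P \<Longrightarrow> h (k y) = y"
    and kh: "\<And>x. x \<in> topspace ?T \<Longrightarrow> k (h x) = x"
    using k by (auto simp: homeomorphic_maps_def)
  have mem: "k (p, w) \<in> topspace ?T" if "p \<in> U" for p w
    using continuous_map_funspace[OF cont] P[OF that] by blast
  have fst_h: "fst (h x) = bproj F x" if "x \<in> topspace ?T" for x
    using h that unfolding local_trivialization_def by auto
  have "continuous_map ?P (tot_space F) k" using cont by (rule continuous_map_into_fulltopology)
  moreover have "open_map ?P ?T k"
    using k homeomorphic_maps_sym homeomorphic_maps_imp_map homeomorphic_imp_open_map by metis
  moreover have "k (p, w) \<in> topspace (tot_space F) \<and> bproj F (k (p, w)) = p \<and> h (k (p, w)) = (p, w)"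
    if "p \<in> U" for p w
    using mem[OF that] hk[OF P[OF that]] fst_h[OF mem[OF that]] by simp
  moreover have "k (h x) = x" if "x \<in> topspace (tot_space F)" "bproj F x \<in> U" for x
    using kh that by simp
  ultimately show ?thesis by (intro exI[of _ k]) simp
qed

text \<open>Sending the local representative \<open>(i, p, w)\<close> to the vector of \<open>F\<close> with coordinates \<open>(p, w)\<close> in the
  \<open>i\<close>-th trivialisation defines a map \<open>\<Psi>\<close> on the disjoint union \<open>D\<close> of the trivial pieces. It is
  continuous, open and surjective, and the hypothesis on \<open>g\<close> says that its fibres are the glueing
  classes. Thus \<open>\<Psi>\<close> and the projection to the glued bundle are quotient maps with the same fibres.\<close>

theorem glued_bundle_isomorphic:
  fixes F :: "('f, 'b) vbundle" and h :: "'i \<Rightarrow> 'f \<Rightarrow> 'b \<times> (real^'n)"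
  assumes F: "vector_bundle TYPE('n) F"
    and U: "\<And>i. openin (base_space F) (U i)" and cover: "topspace (base_space F) = (\<Union>i. U i)"
    and h: "\<And>i. local_trivialization F (U i) (h i)"
    and g: "\<And>i j x. x \<in> topspace (tot_space F) \<Longrightarrow> bproj F x \<in> U i \<inter> U j \<Longrightarrow>
      snd (h i x) = g i j (bproj F x) *v snd (h j x)"
  shows "isomorphic_vector_bundles TYPE('n) (glued_bundle (base_space F) U g) F"
proof -
  let ?X = "base_space F" and ?R = "euclidean :: (real^'n) topology"
  let ?E = "glued_bundle ?X U g"
  define D where "D = subtopology (prod_topology (discrete_topology UNIV) (prod_topology ?X ?R))
    {(i, p, w). p \<in> U i}"
  have "\<forall>i. \<exists>k. continuous_map (prod_topology (subtopology ?X (U i)) ?R) (tot_space F) k \<and>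
    open_map (prod_topology (subtopology ?X (U i)) ?R) (subtopology (tot_space F) {x. bproj F x \<in> U i}) k \<and>
    (\<forall>p w. p \<in> U i \<longrightarrow> k (p, w) \<in> topspace (tot_space F) \<and> bproj F (k (p, w)) = p \<and> h i (k (p, w)) = (p, w)) \<and>
    (\<forall>x \<in> topspace (tot_space F). bproj F x \<in> U i \<longrightarrow> k (h i x) = x)"
    using local_trivialization_inverse[OF h U] by (rule allI)
  from choice[OF this] obtain k where
    "\<forall>i. continuous_map (prod_topology (subtopology ?X (U i)) ?R) (tot_space F) (k i) \<and>
    open_map (prod_topology (subtopology ?X (U i)) ?R) (subtopology (tot_space F) {x. bproj F x \<in> U i}) (k i) \<and>
    (\<forall>p w. p \<in> U i \<longrightarrow> k i (p, w) \<in> topspace (tot_space F) \<and> bproj F (k i (p, w)) = p \<and> h i (k i (p, w)) = (p, w)) \<and>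
    (\<forall>x \<in> topspace (tot_space F). bproj F x \<in> U i \<longrightarrow> k i (h i x) = x)" by (elim exE)
  then have cont: "\<And>i. continuous_map (prod_topology (subtopology ?X (U i)) ?R) (tot_space F) (k i)"
    and k: "\<And>i p w. p \<in> U i \<Longrightarrow> k i (p, w) \<in> topspace (tot_space F)"
      "\<And>i p w. p \<in> U i \<Longrightarrow> bproj F (k i (p, w)) = p"
      "\<And>i p w. p \<in> U i \<Longrightarrow> h i (k i (p, w)) = (p, w)"
      "\<And>i x. x \<in> topspace (tot_space F) \<Longrightarrow> bproj F x \<in> U i \<Longrightarrow> k i (h i x) = x"
    and opn: "\<And>i. open_map (prod_topology (subtopology ?X (U i)) ?R)
      (subtopology (tot_space F) {x. bproj F x \<in> U i}) (k i)"
    by simp_all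
  define \<Psi> where "\<Psi> = (\<lambda>(i, y). k i y)"
  have sub: "U i \<subseteq> topspace ?X" for i using cover by blast
  have D: "topspace D = {(i, p, w). p \<in> U i}" using sub by (auto simp: D_def)
  have fst_h: "fst (h i x) = bproj F x" if "x \<in> topspace (tot_space F)" "bproj F x \<in> U i" for i x
    using h[of i] that by (simp add: local_trivialization_def)
  \<comment> \<open>The glueing relation is the kernel of \<open>\<Psi>\<close>.\<close>
  have rel: "((i, p, w), (j, p', w')) \<in> glue_rel U g \<longleftrightarrow>
      p' \<in> U j \<and> \<Psi> (j, p', w') = \<Psi> (i, p, w)" if p: "p \<in> U i" for i j p p' w w'
  proof
    assume "((i, p, w), (j, p', w')) \<in> glue_rel U g"
    then have *: "p \<in> U j" "p' = p" "w = g i j p *v w'" by (auto simp: glue_rel_def)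
    let ?x = "k j (p, w')"
    have "snd (h i ?x) = w" using g[of ?x i j] k * p by simp
    then have "h i ?x = (p, w)" using fst_h[of ?x i] k * p by (metis prod.collapse)
    then have "k i (p, w) = ?x" using k(4)[of ?x i] k * p by metis
    then show "p' \<in> U j \<and> \<Psi> (j, p', w') = \<Psi> (i, p, w)" using * by (simp add: \<Psi>_def)
  next
    assume *: "p' \<in> U j \<and> \<Psi> (j, p', w') = \<Psi> (i, p, w)"
    then have eq: "k j (p', w') = k i (p, w)" by (simp add: \<Psi>_def)
    then have pp: "p' = p" using k(2) * p by metis
    have "w = snd (h i (k i (p, w)))" "w' = snd (h j (k i (p, w)))"
      using k(3)[OF p, of w] k(3)[of p' j w'] * eq by simp_all
    then have "w = g i j p *v w'" using g[of "k i (p, w)" i j] k p * pp by auto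
    then show "((i, p, w), (j, p', w')) \<in> glue_rel U g" using p * pp by (auto simp: glue_rel_def)
  qed
  have cls: "glue_class U g y = {y' \<in> topspace D. \<Psi> y' = \<Psi> y}" if "y \<in> topspace D" for y
    using that unfolding D glue_class_def by (auto simp: rel Image_iff)
  have cls_eq: "glue_class U g y = glue_class U g y' \<longleftrightarrow> \<Psi> y = \<Psi> y'"
    if "y \<in> topspace D" "y' \<in> topspace D" for y y'
    using that by (auto simp: cls)
  have totE: "tot_space ?E = quotient_topology D (glue_class U g)"
    by (simp add: glued_bundle_def D_def)
  have q: "quotient_map D (tot_space ?E) (glue_class U g)"
    unfolding totE by (rule quotient_map_quotient_topology)
  have topE: "topspace (tot_space ?E) = glue_class U g ` topspace D"
    by (simp add: totE topspace_quotient_topology)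
  have \<Psi>_proj: "bproj F (\<Psi> (i, p, w)) = p" "\<Psi> (i, p, w) \<in> topspace (tot_space F)" if "p \<in> U i" for i p w
    using k that by (simp_all add: \<Psi>_def)
  have projE: "bproj ?E (glue_class U g (i, p, w)) = p" if "p \<in> U i" for i p w
    unfolding glued_bundle_def vbundle.simps
  proof (rule the_equality)
    show "\<exists>i' w'. (i', p, w') \<in> glue_class U g (i, p, w)"
      using that by (auto simp: cls D)
    show "p' = p" if "\<exists>i' w'. (i', p', w') \<in> glue_class U g (i, p, w)" for p'
      using that \<open>p \<in> U i\<close> by (auto simp: cls D) (metis \<Psi>_proj(1))
  qed
  have fibre: "snd (h i (vscale F c x)) = c *\<^sub>R snd (h i x)"
    "y \<in> topspace (tot_space F) \<Longrightarrow> bproj F y = bproj F x \<Longrightarrow>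
      snd (h i (vadd F x y)) = snd (h i x) + snd (h i y)"
    if "x \<in> topspace (tot_space F)" "bproj F x \<in> U i" for i x y c
    using h[of i] that by (simp_all add: local_trivialization_def)
  have opsF: "vscale F c x \<in> topspace (tot_space F)" "bproj F (vscale F c x) = bproj F x"
    "y \<in> topspace (tot_space F) \<Longrightarrow> bproj F x = bproj F y \<Longrightarrow> vadd F x y \<in> topspace (tot_space F)"
    "y \<in> topspace (tot_space F) \<Longrightarrow> bproj F x = bproj F y \<Longrightarrow> bproj F (vadd F x y) = bproj F x"
    if "x \<in> topspace (tot_space F)" for x y c
    using F that by (auto simp: vector_bundle_def)
  have \<Psi>_scale: "\<Psi> (i, p, c *\<^sub>R w) = vscale F c (\<Psi> (i, p, w))" if "p \<in> U i" for i p c w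
  proof -
    let ?x = "vscale F c (k i (p, w))"
    have "snd (h i ?x) = c *\<^sub>R w" using fibre(1)[of "k i (p, w)" i] k that by simp
    then have "h i ?x = (p, c *\<^sub>R w)" using fst_h[of ?x i] opsF k that by (metis prod.collapse)
    then show ?thesis using k(4)[of ?x i] opsF k that by (simp add: \<Psi>_def)
  qed
  have \<Psi>_add: "\<Psi> (i, p, v + w) = vadd F (\<Psi> (i, p, v)) (\<Psi> (i, p, w))" if "p \<in> U i" for i p v w
  proof -
    let ?x = "vadd F (k i (p, v)) (k i (p, w))"
    have x: "?x \<in> topspace (tot_space F)" "bproj F ?x = p" using opsF k that by simp_all
    have "snd (h i ?x) = v + w" using fibre(2)[of "k i (p, v)" i "k i (p, w)"] k that by simp
    then have "h i ?x = (p, v + w)" using fst_h[of ?x i] x that by (metis prod.collapse)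
    then show ?thesis using k(4)[of ?x i] x that by (simp add: \<Psi>_def)
  qed
  have scaleE: "vscale ?E c (glue_class U g (i, p, w)) = glue_class U g (i, p, c *\<^sub>R w)"
    if "p \<in> U i" for i p c w
    unfolding glued_bundle_def vbundle.simps
  proof (rule the_equality)
    fix z
    assume "\<exists>j p' v. p' \<in> U j \<and> glue_class U g (i, p, w) = glue_class U g (j, p', v) \<and>
      z = glue_class U g (j, p', c *\<^sub>R v)"
    then obtain j p' v where *: "p' \<in> U j" "glue_class U g (i, p, w) = glue_class U g (j, p', v)"
      "z = glue_class U g (j, p', c *\<^sub>R v)" by blast
    then have "\<Psi> (i, p, w) = \<Psi> (j, p', v)" using cls_eq that by (auto simp: D)
    then have "\<Psi> (i, p, c *\<^sub>R w) = \<Psi> (j, p', c *\<^sub>R v)" using \<Psi>_scale * that by simp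
    then show "z = glue_class U g (i, p, c *\<^sub>R w)" using cls_eq that * by (auto simp: D)
  qed (use that in blast)
  have addE: "vadd ?E (glue_class U g (i, p, v)) (glue_class U g (i, p, w)) = glue_class U g (i, p, v + w)"
    if "p \<in> U i" for i p v w
    unfolding glued_bundle_def vbundle.simps
  proof (rule the_equality)
    fix z
    assume "\<exists>j p' v' w'. p' \<in> U j \<and> glue_class U g (i, p, v) = glue_class U g (j, p', v') \<and>
      glue_class U g (i, p, w) = glue_class U g (j, p', w') \<and> z = glue_class U g (j, p', v' + w')"
    then obtain j p' v' w' where *: "p' \<in> U j" "glue_class U g (i, p, v) = glue_class U g (j, p', v')"
      "glue_class U g (i, p, w) = glue_class U g (j, p', w')" "z = glue_class U g (j, p', v' + w')" by blast
    then have "\<Psi> (i, p, v) = \<Psi> (j, p', v')" "\<Psi> (i, p, w) = \<Psi> (j, p', w')"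
      using cls_eq that by (auto simp: D)
    then have "\<Psi> (i, p, v + w) = \<Psi> (j, p', v' + w')" using \<Psi>_add * that by simp
    then show "z = glue_class U g (i, p, v + w)" using cls_eq that * by (auto simp: D)
  qed (use that in blast)
  \<comment> \<open>Two vectors in the same fibre have representatives in a common chart, so they can be added there.\<close>
  have pair: "\<exists>i p v w. p \<in> U i \<and> x = glue_class U g (i, p, v) \<and> y = glue_class U g (i, p, w)"
    if xy: "x \<in> topspace (tot_space ?E)" "y \<in> topspace (tot_space ?E)" "bproj ?E y = bproj ?E x" for x y
  proof -
    obtain i p v j p' w where *: "p \<in> U i" "x = glue_class U g (i, p, v)"
      "p' \<in> U j" "y = glue_class U g (j, p', w)"
      using xy(1,2) unfolding topE D by auto
    have [simp]: "p' = p" using projE * xy(3) by metis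
    let ?z = "\<Psi> (j, p, w)"
    have "h i ?z = (p, snd (h i ?z))"
      using fst_h[of ?z i] \<Psi>_proj * by (metis \<open>p' = p\<close> prod.collapse)
    then have "\<Psi> (i, p, snd (h i ?z)) = ?z"
      using k(4)[of ?z i] \<Psi>_proj * unfolding \<Psi>_def by (metis \<open>p' = p\<close> case_prod_conv)
    then have "y = glue_class U g (i, p, snd (h i ?z))"
      using cls_eq[of "(j, p, w)" "(i, p, snd (h i ?z))"] * by (simp add: D)
    with * show ?thesis by blast
  qed
  let ?P = "\<lambda>i. prod_topology (subtopology ?X (U i)) ?R"
  have P: "?P i = subtopology (prod_topology ?X ?R) (U i \<times> UNIV)" for i
    by (simp add: subtopology_Times)
  \<comment> \<open>The topology of \<open>D\<close> is that of the disjoint union of the pieces.\<close>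
  have open_D: "openin D S \<longleftrightarrow> S \<subseteq> topspace D \<and> (\<forall>i. openin (?P i) {y. (i, y) \<in> S})" for S
  proof (intro iffI conjI allI)
    assume S: "openin D S"
    then show sD: "S \<subseteq> topspace D" by (rule openin_subset)
    fix i
    have "continuous_map (?P i) D (\<lambda>y. (i, y))"
      unfolding D_def
    proof (rule continuous_map_into_subtopology)
      show "continuous_map (?P i) (prod_topology (discrete_topology UNIV) (prod_topology ?X ?R)) (\<lambda>y. (i, y))"
        unfolding P by (intro continuous_map_pairedI continuous_map_from_subtopology) auto
    qed auto
    then have "openin (?P i) {y \<in> topspace (?P i). (i, y) \<in> S}"
      using S by (rule openin_continuous_map_preimage)
    moreover have "{y \<in> topspace (?P i). (i, y) \<in> S} = {y. (i, y) \<in> S}"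
      using sD sub by (auto simp: D)
    ultimately show "openin (?P i) {y. (i, y) \<in> S}" by simp
  next
    assume S: "S \<subseteq> topspace D \<and> (\<forall>i. openin (?P i) {y. (i, y) \<in> S})"
    have "openin (prod_topology (discrete_topology UNIV) (prod_topology ?X ?R)) ({i} \<times> {y. (i, y) \<in> S})" for i
    proof -
      have "openin (prod_topology ?X ?R) (U i \<times> UNIV)"
        using U by (simp add: openin_prod_Times_iff)
      then have "openin (prod_topology ?X ?R) {y. (i, y) \<in> S}"
        using S unfolding P by (blast intro: openin_trans_full)
      then show ?thesis by (simp add: openin_prod_Times_iff)
    qed
    then have "openin (prod_topology (discrete_topology UNIV) (prod_topology ?X ?R)) (\<Union>i. {i} \<times> {y. (i, y) \<in> S})"
      by blast
    moreover have "S = (\<Union>i. {i} \<times> {y. (i, y) \<in> S}) \<inter> {(i, p, w). p \<in> U i}"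
      using S by (auto simp: D)
    ultimately show "openin D S"
      unfolding D_def openin_subtopology by blast
  qed
  have contD: "continuous_map D (tot_space F) \<Psi>"
    unfolding continuous_map_def
  proof (intro conjI allI impI)
    show "\<Psi> \<in> topspace D \<rightarrow> topspace (tot_space F)"
      using \<Psi>_proj by (auto simp: D)
    fix V assume V: "openin (tot_space F) V"
    have "{y. (i, y) \<in> {y \<in> topspace D. \<Psi> y \<in> V}} = {y \<in> topspace (?P i). k i y \<in> V}" for i
      using sub by (auto simp: D \<Psi>_def)
    then show "openin D {y \<in> topspace D. \<Psi> y \<in> V}"
      using openin_continuous_map_preimage[OF cont V] by (auto simp: open_D)
  qed
  have proj_cont: "continuous_map (tot_space F) ?X (bproj F)"
    using F by (simp add: vector_bundle_def)
  have openD: "open_map D (tot_space F) \<Psi>"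
    unfolding open_map_def
  proof (intro allI impI)
    fix S assume S: "openin D S"
    have "openin (tot_space F) (k i ` {y. (i, y) \<in> S})" for i
    proof -
      have "{x \<in> topspace (tot_space F). bproj F x \<in> U i} = topspace (tot_space F) \<inter> {x. bproj F x \<in> U i}"
        by auto
      then have "subtopology (tot_space F) {x. bproj F x \<in> U i} =
          subtopology (tot_space F) {x \<in> topspace (tot_space F). bproj F x \<in> U i}"
        by (simp add: subtopology_restrict)
      moreover have "openin (subtopology (tot_space F) {x. bproj F x \<in> U i}) (k i ` {y. (i, y) \<in> S})"
        using opn[of i] S by (simp add: open_map_def open_D)
      ultimately have "openin (subtopology (tot_space F) {x \<in> topspace (tot_space F). bproj F x \<in> U i})
          (k i ` {y. (i, y) \<in> S})" by simp
      moreover have "openin (tot_space F) {x \<in> topspace (tot_space F). bproj F x \<in> U i}"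
        using proj_cont U by (rule openin_continuous_map_preimage)
      ultimately show ?thesis by (rule openin_trans_full)
    qed
    then have "openin (tot_space F) (\<Union>i. k i ` {y. (i, y) \<in> S})"
      by (intro openin_Union) auto
    moreover have "\<Psi> ` S = (\<Union>i. k i ` {y. (i, y) \<in> S})"
    proof (intro equalityI subsetI)
      fix x assume "x \<in> \<Psi> ` S"
      then obtain i y where "(i, y) \<in> S" "x = k i y" by (auto simp: \<Psi>_def)
      then show "x \<in> (\<Union>i. k i ` {y. (i, y) \<in> S})" by (intro UN_I image_eqI) auto
    next
      fix x assume "x \<in> (\<Union>i. k i ` {y. (i, y) \<in> S})"
      then obtain i y where "(i, y) \<in> S" "x = \<Psi> (i, y)" by (auto simp: \<Psi>_def)
      then show "x \<in> \<Psi> ` S" by simp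
    qed
    ultimately show "openin (tot_space F) (\<Psi> ` S)" by simp
  qed
  have surjD: "\<Psi> ` topspace D = topspace (tot_space F)"
  proof
    show "\<Psi> ` topspace D \<subseteq> topspace (tot_space F)" using \<Psi>_proj by (auto simp: D)
    show "topspace (tot_space F) \<subseteq> \<Psi> ` topspace D"
    proof
      fix x assume x: "x \<in> topspace (tot_space F)"
      then have "bproj F x \<in> topspace ?X" using continuous_map_funspace[OF proj_cont] by blast
      then obtain i where i: "bproj F x \<in> U i" unfolding cover by blast
      have "h i x = (bproj F x, snd (h i x))" using fst_h[OF x i] by (metis prod.collapse)
      then have "x = \<Psi> (i, bproj F x, snd (h i x))"
        using k(4)[OF x i] by (simp add: \<Psi>_def)
      moreover have "(i, bproj F x, snd (h i x)) \<in> topspace D" using i by (simp add: D)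
      ultimately show "x \<in> \<Psi> ` topspace D" by (rule image_eqI)
    qed
  qed
  have q\<Psi>: "quotient_map D (tot_space F) \<Psi>"
    using continuous_open_quotient_map[OF contD openD] surjD by simp
  obtain \<phi> where \<phi>: "continuous_map (tot_space ?E) (tot_space F) \<phi>"
    "\<And>y. y \<in> topspace D \<Longrightarrow> \<phi> (glue_class U g y) = \<Psi> y"
    using quotient_map_lift_exists[OF q contD] cls_eq by metis
  have "quotient_map D (tot_space F) (\<phi> \<circ> glue_class U g)"
    using quotient_map_eq[OF q\<Psi>] \<phi>(2) by simp
  then have "quotient_map (tot_space ?E) (tot_space F) \<phi>"
    using quotient_map_from_composition[OF quotient_imp_continuous_map[OF q] \<phi>(1)] by blast
  moreover have "inj_on \<phi> (topspace (tot_space ?E))"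
    unfolding topE by (auto simp: inj_on_def \<phi>(2) cls_eq)
  ultimately have hom: "homeomorphic_map (tot_space ?E) (tot_space F) \<phi>"
    by (simp add: homeomorphic_map_def)
  have repr: "\<exists>i p w. p \<in> U i \<and> x = glue_class U g (i, p, w)" if "x \<in> topspace (tot_space ?E)" for x
    using that unfolding topE D by auto
  have iso: "bundle_isomorphism ?E F \<phi>"
    unfolding bundle_isomorphism_def
  proof (intro conjI ballI allI impI hom)
    fix x assume x: "x \<in> topspace (tot_space ?E)"
    from repr[OF x] obtain i p w where *: "p \<in> U i" "x = glue_class U g (i, p, w)"
      by (elim exE conjE)
    show "bproj F (\<phi> x) = bproj ?E x"
      using * by (simp add: projE \<phi>(2) D \<Psi>_proj)
    show "\<phi> (vscale ?E c x) = vscale F c (\<phi> x)" for c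
      using * by (simp add: scaleE \<phi>(2) D \<Psi>_scale)
  next
    fix x y assume "x \<in> topspace (tot_space ?E)" "y \<in> topspace (tot_space ?E)" "bproj ?E y = bproj ?E x"
    from pair[OF this] obtain i p v w where "p \<in> U i" "x = glue_class U g (i, p, v)"
      "y = glue_class U g (i, p, w)" by (elim exE conjE)
    then show "\<phi> (vadd ?E x y) = vadd F (\<phi> x) (\<phi> y)"
      by (simp add: addE \<phi>(2) D \<Psi>_add)
  qed
  have base: "base_space ?E = ?X" by (simp add: glued_bundle_def)
  have "vector_bundle TYPE('n) ?E"
  proof (rule vector_bundle_transport[OF F iso base])
    fix x c assume x: "x \<in> topspace (tot_space ?E)"
    from repr[OF x] obtain i p w where "p \<in> U i" "x = glue_class U g (i, p, w)" by (elim exE conjE)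
    then show "vscale ?E c x \<in> topspace (tot_space ?E) \<and> bproj ?E (vscale ?E c x) = bproj ?E x"
      by (simp add: scaleE projE topE D)
  next
    fix x y assume "x \<in> topspace (tot_space ?E)" "y \<in> topspace (tot_space ?E)" "bproj ?E x = bproj ?E y"
    from pair[OF this(1,2) this(3)[symmetric]] obtain i p v w where "p \<in> U i"
      "x = glue_class U g (i, p, v)" "y = glue_class U g (i, p, w)" by (elim exE conjE)
    then show "vadd ?E x y \<in> topspace (tot_space ?E) \<and> bproj ?E (vadd ?E x y) = bproj ?E x"
      by (simp add: addE projE topE D)
  qed
  with F iso base show ?thesis
    unfolding isomorphic_vector_bundles_def by blast
qed

section \<open>Powers of the tautological line bundle\<close>

lemma topspace_real_projective_space:
  "topspace (real_projective_space :: (real^'m) set topology) = (\<lambda>\<alpha>. span {\<alpha>}) ` (- {0})"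
  by (simp add: real_projective_space_def topspace_quotient_topology)

text \<open>The representative of the line \<open>p\<close> whose \<open>i\<close>-th coordinate is 1.\<close>

definition normalized_coords :: "'m::finite \<Rightarrow> (real^'m) set \<Rightarrow> real^'m" where
  "normalized_coords i p = (1 / hom_coords p $ i) *\<^sub>R hom_coords p"

lemma normalized_coords_span:
  fixes a :: "real^'m"
  assumes "a $ i \<noteq> 0"
  shows "normalized_coords i (span {a}) = (1 / a $ i) *\<^sub>R a"
proof -
  have "a \<noteq> 0" using assms by auto
  then obtain c where "c \<noteq> 0" "hom_coords (span {a}) = c *\<^sub>R a" using hom_coords_span by blast
  then show ?thesis by (simp add: normalized_coords_def)
qed

lemma coord_chart_cases:
  fixes p :: "(real^'m) set"
  assumes "p \<in> coord_chart i"
  obtains a where "a $ i = 1" "p = span {a}" "normalized_coords i p = a"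
proof -
  obtain b :: "real^'m" where b: "b \<noteq> 0" "p = span {b}"
    using assms by (auto simp: coord_chart_def topspace_real_projective_space)
  with assms have bi: "b $ i \<noteq> 0" by (simp add: coord_chart_span)
  define a where "a = (1 / b $ i) *\<^sub>R b"
  have "p = span {a}"
    unfolding b(2) a_def span_singleton using bi by (force simp: image_iff intro: exI[of _ "_ * b $ i"])
  moreover have "a $ i = 1" using bi by (simp add: a_def)
  ultimately show thesis using that[of a] normalized_coords_span[of a i] by simp
qed

lemma span_in_coord_chart: "a $ i \<noteq> 0 \<Longrightarrow> span {a} \<in> coord_chart i"
  by (subst coord_chart_span) auto

lemma openin_coord_chart: "openin real_projective_space (coord_chart i :: (real^'m::finite) set set)"
proof -
  have "{a \<in> - {0}. span {a} \<in> coord_chart i} = {a :: real^'m. a $ i \<noteq> 0}"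
    using span_in_coord_chart by (auto simp: coord_chart_span)
  moreover have "open {a :: real^'m. a $ i \<noteq> 0}"
    by (intro open_Collect_neq continuous_intros)
  moreover have "coord_chart i \<subseteq> (\<lambda>\<alpha>. span {\<alpha>}) ` (- {0 :: real^'m})"
    by (auto simp: coord_chart_def topspace_real_projective_space)
  ultimately show ?thesis
    unfolding real_projective_space_def openin_quotient_topology
    by (auto simp: openin_open_subtopology open_Compl)
qed

lemma Union_coord_chart:
  "topspace real_projective_space = (\<Union>i. coord_chart i :: (real^'m::finite) set set)"
proof
  show "topspace real_projective_space \<subseteq> (\<Union>i. coord_chart i :: (real^'m) set set)"
  proof
    fix p :: "(real^'m) set" assume "p \<in> topspace real_projective_space"
    then obtain a :: "real^'m" where a: "a \<noteq> 0" "p = span {a}"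
      by (auto simp: topspace_real_projective_space)
    then obtain i where "a $ i \<noteq> 0" by (auto simp: vec_eq_iff)
    with a show "p \<in> (\<Union>i. coord_chart i)" using span_in_coord_chart by blast
  qed
qed (auto simp: coord_chart_def)

text \<open>The chart is the quotient of the open set of points with nonzero \<open>i\<close>-th coordinate, and there the
  composite with the projection is an explicit continuous function.\<close>

lemma continuous_map_normalized_coords:
  "continuous_map (subtopology real_projective_space (coord_chart i)) euclidean
    (normalized_coords i :: (real^'m::finite) set \<Rightarrow> real^'m)"
proof -
  let ?X = "subtopology euclidean (- {0 :: real^'m})" and ?S = "{a :: real^'m. a $ i \<noteq> 0}"
  have "quotient_map ?X real_projective_space (\<lambda>\<alpha>. span {\<alpha>})"
    unfolding real_projective_space_def by (rule quotient_map_quotient_topology)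
  moreover have "{a \<in> topspace ?X. span {a} \<in> coord_chart i} = ?S"
    using span_in_coord_chart by (auto simp: coord_chart_span)
  ultimately have "quotient_map (subtopology ?X ?S) (subtopology real_projective_space (coord_chart i)) (\<lambda>\<alpha>. span {\<alpha>})"
    using openin_coord_chart[of i] by (intro quotient_map_restriction) auto
  moreover have "subtopology ?X ?S = top_of_set ?S"
    by (auto simp: subtopology_subtopology intro: arg_cong[of _ _ "subtopology euclidean"])
  ultimately have q: "quotient_map (top_of_set ?S) (subtopology real_projective_space (coord_chart i)) (\<lambda>\<alpha>. span {\<alpha>})"
    by metis
  have "continuous_on ?S (\<lambda>a. (1 / a $ i) *\<^sub>R a)"
    by (intro continuous_intros) auto
  then have "continuous_map (top_of_set ?S) euclidean (normalized_coords i \<circ> (\<lambda>\<alpha>. span {\<alpha>}))"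
    unfolding continuous_map_iff_continuous
    by (rule continuous_on_cong[THEN iffD1, rotated -1]) (auto simp: normalized_coords_span)
  with q show ?thesis by (rule continuous_compose_quotient_map)
qed

lemma continuous_map_vec_lambda:
  fixes f :: "'x \<Rightarrow> 'k::finite \<Rightarrow> real"
  assumes "\<And>k. continuous_map X euclideanreal (\<lambda>x. f x k)"
  shows "continuous_map X euclidean (\<lambda>x. \<chi> k. f x k)"
proof -
  have "continuous_map X (product_topology (\<lambda>_. euclidean) UNIV) f"
    using assms by (simp add: continuous_map_componentwise_UNIV)
  then have "continuous_map X euclidean f" by (simp add: euclidean_product_topology)
  moreover have "continuous_map euclidean euclidean (\<lambda>g :: 'k \<Rightarrow> real. \<chi> k. g k)"
    by (auto intro!: continuous_intros continuous_on_product_coordinates)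
  ultimately have "continuous_map X euclidean ((\<lambda>g. \<chi> k. g k) \<circ> f)"
    by (rule continuous_map_compose)
  then show ?thesis by (simp add: o_def)
qed

lemma continuous_map_vec_nth:
  fixes f :: "'x \<Rightarrow> 'a::topological_space^'k::finite"
  assumes "continuous_map X euclidean f"
  shows "continuous_map X euclidean (\<lambda>x. f x $ k)"
proof -
  have "continuous_map euclidean euclidean (\<lambda>v :: 'a^'k. v $ k)"
    by (auto intro!: continuous_intros)
  from continuous_map_compose[OF assms this] show ?thesis by (simp add: o_def)
qed

lemma continuous_map_matrix_vector_mult:
  fixes A :: "'x \<Rightarrow> real^'n::finite^'n"
  assumes "continuous_map X euclidean A" "continuous_map X euclidean v"
  shows "continuous_map X euclidean (\<lambda>x. A x *v v x)"
  unfolding matrix_vector_mult_def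
  by (intro continuous_map_vec_lambda continuous_map_sum continuous_map_real_mult
      continuous_map_vec_nth assms) auto

lemma continuous_map_scaleR_vec:
  fixes v :: "'x \<Rightarrow> real^'k::finite"
  assumes "continuous_map X euclideanreal c" "continuous_map X euclidean v"
  shows "continuous_map X euclidean (\<lambda>x. c x *\<^sub>R v x)"
proof -
  have "continuous_map X euclidean (\<lambda>x. \<chi> k. c x * v x $ k)"
    by (intro continuous_map_vec_lambda continuous_map_real_mult continuous_map_vec_nth assms)
  then show ?thesis by (rule continuous_map_eq) (simp add: vec_eq_iff)
qed

abbreviation taut_power ::
  "'n::finite itself \<Rightarrow> 'm::finite itself \<Rightarrow>
    ((real^'m) set \<times> ('n \<Rightarrow> (real^'m) set \<times> (real^'m)), (real^'m) set) vbundle" where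
  "taut_power N D \<equiv> whitney_power N (taut_bundle D)"

lemma topspace_taut_power:
  "topspace (tot_space (taut_power TYPE('n::finite) TYPE('m::finite))) =
    {(p, f). p \<in> topspace real_projective_space \<and> (\<forall>k. fst (f k) = p \<and> snd (f k) \<in> p)}"
proof (rule set_eqI)
  fix x :: "(real^'m) set \<times> ('n \<Rightarrow> (real^'m) set \<times> (real^'m))"
  obtain p f where x: "x = (p, f)" by fastforce
  show "x \<in> topspace (tot_space (taut_power TYPE('n) TYPE('m))) \<longleftrightarrow>
    x \<in> {(p, f). p \<in> topspace real_projective_space \<and> (\<forall>k. fst (f k) = p \<and> snd (f k) \<in> p)}"
    unfolding x by (simp add: whitney_power_def taut_bundle_def PiE_iff mem_Times_iff case_prod_beta) fast
qed

text \<open>A vector on a line in the chart \<open>i\<close> is determined by its \<open>i\<close>-th coordinate; the matrix \<open>A\<close> changes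
  the resulting frame.\<close>

definition coord_trivialization ::
  "'m::finite \<Rightarrow> ((real^'m) set \<Rightarrow> real^'n::finite^'n) \<Rightarrow>
    (real^'m) set \<times> ('n \<Rightarrow> (real^'m) set \<times> (real^'m)) \<Rightarrow> (real^'m) set \<times> (real^'n)" where
  "coord_trivialization i A x = (fst x, A (fst x) *v (\<chi> k. snd (snd x k) $ i))"

lemma local_trivialization_taut_power:
  fixes A B :: "(real^'m::finite) set \<Rightarrow> real^'n::finite^'n"
  assumes A: "continuous_map (subtopology real_projective_space (coord_chart i)) euclidean A"
    and B: "continuous_map (subtopology real_projective_space (coord_chart i)) euclidean B"
    and inv: "\<And>p. p \<in> coord_chart i \<Longrightarrow> A p ** B p = mat 1"
  shows "local_trivialization (taut_power TYPE('n) TYPE('m)) (coord_chart i) (coord_trivialization i A)"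
proof -
  let ?E = "taut_power TYPE('n) TYPE('m)" and ?U = "coord_chart i :: (real^'m) set set"
  let ?RP = "real_projective_space :: (real^'m) set topology"
  let ?T = "subtopology (tot_space ?E) {x. bproj ?E x \<in> ?U}"
  let ?P = "prod_topology (subtopology ?RP ?U) (euclidean :: (real^'n) topology)"
  let ?h = "coord_trivialization i A"
  \<comment> \<open>The inverse of \<open>?h\<close>: the entries of the matrix product are the \<open>i\<close>-th coordinates of the vectors.\<close>
  define s where "s = (\<lambda>y :: (real^'m) set \<times> (real^'n).
    (fst y, \<lambda>k. (fst y, (B (fst y) *v snd y) $ k *\<^sub>R normalized_coords i (fst y))))"
  have U: "?U \<subseteq> topspace ?RP" by (auto simp: coord_chart_def)
  have inv': "B p ** A p = mat 1" if "p \<in> ?U" for p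
    using inv[OF that] by (simp add: matrix_left_right_inverse)
  have topT: "topspace ?T = {(p, f). p \<in> ?U \<and> (\<forall>k. fst (f k) = p \<and> snd (f k) \<in> p)}"
    using U unfolding topspace_subtopology topspace_taut_power by (auto simp: whitney_power_def)
  have line: "normalized_coords i p $ i = 1" "c *\<^sub>R normalized_coords i p \<in> p"
    "v \<in> p \<Longrightarrow> v $ i *\<^sub>R normalized_coords i p = v" if "p \<in> ?U" for p v c
  proof -
    obtain a where a: "a $ i = 1" "p = span {a}" "normalized_coords i p = a"
      by (rule coord_chart_cases[OF \<open>p \<in> ?U\<close>])
    show "normalized_coords i p $ i = 1" using a by simp
    show "c *\<^sub>R normalized_coords i p \<in> p" unfolding a(3) unfolding a(2) by (simp add: span_base span_scale)
    show "v $ i *\<^sub>R normalized_coords i p = v" if "v \<in> p"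
      using that a(1) unfolding a(3) unfolding a(2) by (auto simp: span_singleton)
  qed
  have base: "base_space ?E = ?RP" by (simp add: whitney_power_def taut_bundle_def)
  have tot: "tot_space ?E = subtopology
      (prod_topology ?RP (product_topology (\<lambda>_. tot_space (taut_bundle TYPE('m))) UNIV))
      {(p, f). \<forall>k. fst (f k) = p}"
    by (simp add: whitney_power_def taut_bundle_def)
  have fst_T: "continuous_map ?T ?RP fst"
    unfolding tot by (intro continuous_map_from_subtopology continuous_map_fst)
  have fst_TU: "continuous_map ?T (subtopology ?RP ?U) fst"
    using fst_T topT by (intro continuous_map_into_subtopology) auto
  have coord_T: "continuous_map ?T euclidean (\<lambda>x. snd (snd x k))" for k
  proof -
    have "continuous_map ?T (product_topology (\<lambda>_. tot_space (taut_bundle TYPE('m))) UNIV) snd"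
      unfolding tot by (intro continuous_map_from_subtopology continuous_map_snd)
    moreover have "continuous_map (product_topology (\<lambda>_. tot_space (taut_bundle TYPE('m))) UNIV)
        (tot_space (taut_bundle TYPE('m))) (\<lambda>f. f k)"
      by (rule continuous_map_product_projection) simp
    moreover have "continuous_map (tot_space (taut_bundle TYPE('m))) euclidean snd"
      unfolding taut_bundle_def by (simp, intro continuous_map_from_subtopology continuous_map_snd)
    ultimately have "continuous_map ?T euclidean (snd \<circ> ((\<lambda>f. f k) \<circ> snd))"
      by (intro continuous_map_compose)
    then show ?thesis by (simp add: o_def)
  qed
  have h: "continuous_map ?T ?P ?h"
    unfolding coord_trivialization_def
    using continuous_map_compose[OF fst_TU A]
    by (intro continuous_map_pairedI fst_TU continuous_map_matrix_vector_mult continuous_map_vec_lambda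
        continuous_map_vec_nth coord_T) (simp add: o_def)
  have fst_P: "continuous_map ?P (subtopology ?RP ?U) fst" by (rule continuous_map_fst)
  then have fst_P': "continuous_map ?P ?RP fst" by (rule continuous_map_into_fulltopology)
  have vec: "continuous_map ?P euclidean
      (\<lambda>y. (B (fst y) *v snd y) $ k *\<^sub>R normalized_coords i (fst y))" for k
    using continuous_map_compose[OF fst_P B]
      continuous_map_compose[OF fst_P continuous_map_normalized_coords[of i]]
    by (intro continuous_map_scaleR_vec continuous_map_vec_nth continuous_map_matrix_vector_mult
        continuous_map_snd) (simp_all add: o_def)
  have taut: "continuous_map ?P (tot_space (taut_bundle TYPE('m)))
      (\<lambda>y. (fst y, (B (fst y) *v snd y) $ k *\<^sub>R normalized_coords i (fst y)))" for k
    unfolding taut_bundle_def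
    by (simp, intro continuous_map_into_subtopology continuous_map_pairedI fst_P' vec) (auto intro: line)
  have s: "continuous_map ?P ?T s"
  proof (rule continuous_map_into_subtopology)
    show "continuous_map ?P (tot_space ?E) s"
      unfolding tot s_def
      by (intro continuous_map_into_subtopology continuous_map_pairedI fst_P')
        (auto simp: continuous_map_componentwise_UNIV intro: taut)
  qed (auto simp: s_def whitney_power_def)
  have "homeomorphic_maps ?T ?P ?h s"
    unfolding homeomorphic_maps_def
  proof (intro conjI ballI h s)
    fix x assume "x \<in> topspace ?T"
    then obtain p f where x: "x = (p, f)" "p \<in> ?U" "\<And>k. fst (f k) = p" "\<And>k. snd (f k) \<in> p"
      unfolding topT by blast
    have "f k = (p, snd (f k) $ i *\<^sub>R normalized_coords i p)" for k
      using x(3)[of k] line(3)[OF x(2) x(4), of k] by (metis prod.collapse)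
    then show "s (?h x) = x"
      by (simp add: s_def coord_trivialization_def x(1) matrix_vector_mul_assoc inv'[OF x(2)])
  next
    fix y assume "y \<in> topspace ?P"
    then have "fst y \<in> ?U" by auto
    then show "?h (s y) = y"
      by (simp add: s_def coord_trivialization_def line(1) matrix_vector_mul_assoc inv)
  qed
  then have "homeomorphic_map ?T ?P ?h" by (rule homeomorphic_maps_imp_map)
  moreover have "snd (?h (vscale ?E c x)) = c *\<^sub>R snd (?h x)" for c x
  proof -
    have "(\<chi> k. snd (snd (vscale ?E c x) k) $ i) = c *\<^sub>R (\<chi> k. snd (snd x k) $ i)"
      by (simp add: whitney_power_def taut_bundle_def vec_eq_iff)
    then show ?thesis
      by (simp add: coord_trivialization_def matrix_vector_mult_scaleR whitney_power_def)
  qed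
  moreover have "snd (?h (vadd ?E x y)) = snd (?h x) + snd (?h y)" if "fst y = fst x" for x y
  proof -
    have "(\<chi> k. snd (snd (vadd ?E x y) k) $ i) = (\<chi> k. snd (snd x k) $ i) + (\<chi> k. snd (snd y k) $ i)"
      by (simp add: whitney_power_def taut_bundle_def vec_eq_iff)
    then show ?thesis
      using that by (simp add: coord_trivialization_def matrix_vector_right_distrib whitney_power_def)
  qed
  moreover have "bproj ?E x = fst x" "fst (?h x) = fst x" for x
    by (simp_all add: whitney_power_def coord_trivialization_def)
  ultimately show ?thesis
    unfolding local_trivialization_def base by simp
qed

lemma vector_bundle_taut_power:
  "vector_bundle TYPE('n::finite) (taut_power TYPE('n) TYPE('m::finite))"
  unfolding vector_bundle_def
proof (intro conjI ballI allI impI)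
  let ?E = "taut_power TYPE('n) TYPE('m)"
  let ?RP = "real_projective_space :: (real^'m) set topology"
  have proj: "bproj ?E = fst" and base: "base_space ?E = ?RP"
    by (simp_all add: whitney_power_def taut_bundle_def)
  have lin: "v \<in> p \<Longrightarrow> c *\<^sub>R v \<in> p" "v \<in> p \<Longrightarrow> w \<in> p \<Longrightarrow> v + w \<in> p"
    if "p \<in> topspace ?RP" for p c v w
  proof -
    have "subspace p" using that by (auto simp: topspace_real_projective_space)
    then show "v \<in> p \<Longrightarrow> c *\<^sub>R v \<in> p" "v \<in> p \<Longrightarrow> w \<in> p \<Longrightarrow> v + w \<in> p"
      by (simp_all add: subspace_scale subspace_add)
  qed
  show "continuous_map (tot_space ?E) (base_space ?E) (bproj ?E)"
    unfolding proj base
    by (auto simp: whitney_power_def taut_bundle_def intro!: continuous_map_from_subtopology continuous_map_fst)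
  show "vscale ?E c x \<in> topspace (tot_space ?E)" "bproj ?E (vscale ?E c x) = bproj ?E x"
    if "x \<in> topspace (tot_space ?E)" for x c
  proof -
    show "vscale ?E c x \<in> topspace (tot_space ?E)"
      using that lin(1) unfolding topspace_taut_power
      by (auto simp: whitney_power_def taut_bundle_def)
  qed (simp add: whitney_power_def)
  show "vadd ?E x y \<in> topspace (tot_space ?E)" "bproj ?E (vadd ?E x y) = bproj ?E x"
    if "x \<in> topspace (tot_space ?E)" "y \<in> topspace (tot_space ?E)" "bproj ?E x = bproj ?E y" for x y
  proof -
    show "vadd ?E x y \<in> topspace (tot_space ?E)"
      using that lin(2) unfolding topspace_taut_power proj
      by (auto simp: whitney_power_def taut_bundle_def)
  qed (simp add: whitney_power_def)
  fix b assume "b \<in> topspace (base_space ?E)"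
  then obtain i where "b \<in> coord_chart i" unfolding base Union_coord_chart by blast
  moreover have "local_trivialization ?E (coord_chart i) (coord_trivialization i (\<lambda>_. mat 1))"
    by (rule local_trivialization_taut_power[where B = "\<lambda>_. mat 1"]) simp_all
  ultimately show "\<exists>U (h :: _ \<Rightarrow> (real^'m) set \<times> (real^'n)). openin (base_space ?E) U \<and> b \<in> U \<and> local_trivialization ?E U h"
    unfolding base using openin_coord_chart by (intro exI conjI)
qed

section \<open>The coordinate-deletion bundle\<close>

lemma continuous_map_chart_matrix:
  fixes H :: "real^'m::finite \<Rightarrow> real^'n::finite^'n"
  assumes "continuous_on {a. a $ i = 1} H"
  shows "continuous_map (subtopology real_projective_space (coord_chart i)) euclidean
    (\<lambda>p. H (normalized_coords i p))"
proof -
  have "continuous_map (subtopology real_projective_space (coord_chart i)) (top_of_set {a. a $ i = 1})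
      (normalized_coords i :: (real^'m) set \<Rightarrow> real^'m)"
  proof (rule continuous_map_into_subtopology[OF continuous_map_normalized_coords], rule funcsetI)
    fix p :: "(real^'m) set"
    assume "p \<in> topspace (subtopology real_projective_space (coord_chart i))"
    then have "p \<in> coord_chart i" by simp
    then show "normalized_coords i p \<in> {a. a $ i = 1}" by (rule coord_chart_cases) simp
  qed
  moreover have "continuous_map (top_of_set {a. a $ i = 1}) euclidean H"
    using assms by simp
  ultimately show ?thesis by (rule continuous_map_compose[unfolded o_def])
qed

text \<open>The factor \<open>1 / t\<close> is the transition function of the tautological line bundle.\<close>

lemma coord_charts_rescale:
  fixes p :: "(real^'m::finite) set"
  assumes "p \<in> coord_chart i" "p \<in> coord_chart j"
  obtains t where "t \<noteq> 0" "normalized_coords i p = t *\<^sub>R normalized_coords j p"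
    "normalized_coords i p $ j = t"
    "\<And>v. v \<in> p \<Longrightarrow> v $ i = (1 / t) * v $ j"
proof -
  obtain a where a: "a $ i = 1" "p = span {a}" "normalized_coords i p = a"
    by (rule coord_chart_cases[OF assms(1)])
  obtain b where b: "b $ j = 1" "p = span {b}" "normalized_coords j p = b"
    by (rule coord_chart_cases[OF assms(2)])
  have "a \<in> span {b}" using a(2) b(2) span_base[of a "{a}"] by simp
  then obtain t where t: "a = t *\<^sub>R b" by (auto simp: span_singleton)
  have "t \<noteq> 0" using t a(1) by auto
  moreover have "a $ j = t" using t b(1) by simp
  moreover have "v $ i = (1 / t) * v $ j" if v: "v \<in> p" for v
  proof -
    have "v \<in> span {a}" using v a(2) by simp
    then obtain c where "v = c *\<^sub>R a" by (auto simp: span_singleton)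
    then show ?thesis using a(1) \<open>a $ j = t\<close> \<open>t \<noteq> 0\<close> by simp
  qed
  ultimately show thesis using that a b t by simp
qed

context composition_algebra
begin

lemma chart_matrix_eq: "chart_matrix m e i p = M (deleted_vector i (normalized_coords i p))"
  by (simp add: chart_matrix_def affine_coord_def deleted_vector_def normalized_coords_def)

text \<open>In the chart \<open>i\<close> the isomorphism is the matrix \<open>H i\<close>, the extension of
  \<open>G (M (deleted_vector i a))\<^sup>-\<^sup>1\<close> over the axis. On overlaps, where the axes are excluded, the odd
  homogeneity of \<open>G\<close> produces exactly the scalar \<open>1 / t\<close> by which \<open>\<gamma>\<close> is glued.\<close>

theorem deletion_bundle_isomorphic_taut_power:
  assumes card: "CARD('m::{finite,linorder}) = CARD('n) + 1" and even: "even CARD('n)"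
  shows "isomorphic_vector_bundles TYPE('n) (deletion_bundle TYPE('m) m e)
    (taut_power TYPE('n) TYPE('m))"
proof -
  let ?F = "taut_power TYPE('n) TYPE('m)"
  from ex_odd_frame[OF card even] obtain G ::
      "real^'m::{finite,linorder} \<Rightarrow> real^'n::{finite,linorder}^'n::{finite,linorder}"
    where odd: "\<forall>t a. t \<noteq> 0 \<longrightarrow> G (t *\<^sub>R a) = (1 / t) *\<^sub>R G a"
      and cont: "continuous_on (off_axes UNIV) G"
      and inv: "\<forall>a \<in> off_axes UNIV. invertible (G a)"
      and tame: "\<forall>i. tame_at i G"
    by (elim exE conjE)
  from choice[OF tame[unfolded tame_at_def]] obtain K where
    K: "\<forall>i. invertible (K i) \<and> ((\<lambda>a. G a ** matrix_inv (M (deleted_vector i a))) \<longlongrightarrow> K i)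
      (at (axis i 1) within {a. a $ i = 1})" by (elim exE)
  define H where "H = (\<lambda>i a. if deleted_vector i a = 0 then K i
    else G a ** matrix_inv (M (deleted_vector i a)))"
  have H_cont: "continuous_on {a. a $ i = 1} (H i)" for i
    unfolding H_def using K by (intro continuous_on_tame_extension[OF card cont]) simp
  have H_inv: "invertible (H i a)" if "a $ i = 1" for i a
  proof (cases "deleted_vector i a = 0")
    case True
    then show ?thesis using K by (simp add: H_def)
  next
    case False
    have "invertible (matrix_inv (M (deleted_vector i a)))"
      using matrix_inv_mult[OF invertible_M[OF False]] unfolding invertible_def by blast
    then show ?thesis
      using False inv off_axes_chart[OF card that False] by (simp add: H_def invertible_mult)
  qed
  let ?A = "\<lambda>i p. matrix_inv (H i (normalized_coords i p))"
  have chart1: "normalized_coords i p $ i = 1" if "p \<in> coord_chart i" for i :: 'm and p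
    using that by (rule coord_chart_cases) simp
  have triv: "local_trivialization ?F (coord_chart i) (coord_trivialization i (?A i))" for i
  proof (rule local_trivialization_taut_power)
    show "continuous_map (subtopology real_projective_space (coord_chart i)) euclidean
        (\<lambda>p. H i (normalized_coords i p))"
      by (rule continuous_map_chart_matrix[OF H_cont])
    have "continuous_on {a. a $ i = 1} (\<lambda>a. matrix_inv (H i a))"
      by (intro continuous_on_matrix_inv H_cont H_inv) simp
    then show "continuous_map (subtopology real_projective_space (coord_chart i)) euclidean (?A i)"
      by (rule continuous_map_chart_matrix)
    show "?A i p ** H i (normalized_coords i p) = mat 1" if "p \<in> coord_chart i" for p
      by (rule matrix_inv_mult(2)[OF H_inv[OF chart1[OF that]]])
  qed
  have H_transition: "H i (normalized_coords i p) ** deletion_transition m e i j p =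
      (1 / t) *\<^sub>R H j (normalized_coords j p)"
    if ij: "i \<noteq> j" and t: "t \<noteq> 0" "normalized_coords i p = t *\<^sub>R normalized_coords j p"
      "normalized_coords i p $ j = t" and p: "p \<in> coord_chart i" "p \<in> coord_chart j" for i j p t
  proof -
    let ?a = "normalized_coords i p" and ?b = "normalized_coords j p"
    \<comment> \<open>A point of the \<open>i\<close>-th axis lies in no other chart.\<close>
    have a: "deleted_vector i ?a \<noteq> 0"
    proof
      assume "deleted_vector i ?a = 0"
      then have "?a = axis i (?a $ i)" unfolding deleted_vector_eq_0_iff[OF card] .
      then have "?a $ j = axis i (?a $ i) $ j" by metis
      then show False using ij t by (simp add: axis_def)
    qed
    have "?a $ i = t * ?b $ i" unfolding t(2) by simp
    then have bi: "?b $ i \<noteq> 0" using chart1[OF p(1)] by auto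
    have b: "deleted_vector j ?b \<noteq> 0"
    proof
      assume "deleted_vector j ?b = 0"
      then have "?b = axis j (?b $ j)" unfolding deleted_vector_eq_0_iff[OF card] .
      then have "?b $ i = axis j (?b $ j) $ i" by metis
      then show False using ij bi by (simp add: axis_def)
    qed
    have "H i ?a ** deletion_transition m e i j p =
        G ?a ** (matrix_inv (M (deleted_vector i ?a)) ** M (deleted_vector i ?a)) **
          matrix_inv (M (deleted_vector j ?b))"
      using a ij by (simp add: H_def deletion_transition_def chart_matrix_eq matrix_mul_assoc)
    also have "\<dots> = G ?a ** matrix_inv (M (deleted_vector j ?b))"
      by (simp add: matrix_inv_mult invertible_M[OF a])
    also have "\<dots> = (1 / t) *\<^sub>R H j ?b"
      using odd t(1) b unfolding t(2) by (simp add: H_def matrix_mult_scaleR)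
    finally show ?thesis .
  qed
  have "isomorphic_vector_bundles TYPE('n)
    (glued_bundle (base_space ?F) coord_chart (deletion_transition m e)) ?F"
  proof (rule glued_bundle_isomorphic[OF vector_bundle_taut_power])
    have base: "base_space ?F = real_projective_space" by (simp add: whitney_power_def taut_bundle_def)
    show "openin (base_space ?F) (coord_chart i)" for i unfolding base by (rule openin_coord_chart)
    show "topspace (base_space ?F) = \<Union> (range coord_chart)" unfolding base by (rule Union_coord_chart)
    show "local_trivialization ?F (coord_chart i) (coord_trivialization i (?A i))" for i by (rule triv)
    fix i j x
    assume x: "x \<in> topspace (tot_space ?F)" and ij: "bproj ?F x \<in> coord_chart i \<inter> coord_chart j"
    obtain p f where pf: "x = (p, f)" by fastforce
    have p: "bproj ?F x = p" by (simp add: whitney_power_def pf)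
    have pi: "p \<in> coord_chart i" and pj: "p \<in> coord_chart j" using ij unfolding p by simp_all
    have fp: "snd (f k) \<in> p" for k using x unfolding topspace_taut_power pf by simp
    let ?Hi = "H i (normalized_coords i p)" and ?Hj = "H j (normalized_coords j p)"
    let ?vi = "\<chi> k. snd (f k) $ i" and ?vj = "\<chi> k. snd (f k) $ j"
    have inv_i: "matrix_inv ?Hi ** ?Hi = mat 1" and inv_j: "?Hj ** matrix_inv ?Hj = mat 1"
      using H_inv chart1 pi pj by (simp_all add: matrix_inv_mult)
    have "matrix_inv ?Hi *v ?vi = deletion_transition m e i j p *v (matrix_inv ?Hj *v ?vj)"
    proof (cases "i = j")
      case True
      then show ?thesis by (simp add: deletion_transition_def)
    next
      case False
      obtain t where t: "t \<noteq> 0" "normalized_coords i p = t *\<^sub>R normalized_coords j p"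
        "normalized_coords i p $ j = t" "\<And>v. v \<in> p \<Longrightarrow> v $ i = (1 / t) * v $ j"
        by (rule coord_charts_rescale[OF pi pj], rule that)
      have "?vi = (1 / t) *\<^sub>R ?vj" using t(4)[OF fp] by (simp add: vec_eq_iff)
      also have "\<dots> = (1 / t) *\<^sub>R (?Hj *v (matrix_inv ?Hj *v ?vj))"
        by (simp add: matrix_vector_mul_assoc inv_j)
      also have "\<dots> = ?Hi *v (deletion_transition m e i j p *v (matrix_inv ?Hj *v ?vj))"
        unfolding matrix_vector_mul_assoc[of ?Hi] H_transition[OF False t(1,2,3) pi pj]
        by (simp add: scaleR_matrix_vector_assoc)
      finally have "matrix_inv ?Hi *v ?vi =
          (matrix_inv ?Hi ** ?Hi) *v (deletion_transition m e i j p *v (matrix_inv ?Hj *v ?vj))"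
        unfolding matrix_vector_mul_assoc[symmetric] by (rule arg_cong)
      then show ?thesis unfolding inv_i by simp
    qed
    then show "snd (coord_trivialization i (?A i) x) =
        deletion_transition m e i j (bproj ?F x) *v snd (coord_trivialization j (?A j) x)"
      unfolding p by (simp add: coord_trivialization_def pf)
  qed
  then show ?thesis
    by (simp add: deletion_bundle_def whitney_power_def taut_bundle_def)
qed

end

lemma composition_algebra_complex:
  "orthonormal_basis e \<Longrightarrow> composition_algebra ((*) :: complex \<Rightarrow> complex \<Rightarrow> complex) e"
  by unfold_locales
    (auto simp: bilinear_conv_bounded_bilinear norm_mult intro: bounded_bilinear_mult)

lemma norm_mult_if_quad_norm_mult:
  "quad_norm u = quad_norm v * quad_norm w \<Longrightarrow> norm u = norm v * norm w"
  by (simp add: quad_norm_def flip: power_mult_distrib)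

lemma bilinear_quat_mult: "bilinear quat_mult"
  by (auto simp: bilinear_def linear_iff quat_mult_def cd_mult_def algebra_simps scaleR_conv_of_real)

lemma composition_algebra_quaternion:
  "orthonormal_basis e \<Longrightarrow> composition_algebra quat_mult e"
proof unfold_locales
  show "bilinear quat_mult" by (rule bilinear_quat_mult)
qed (rule norm_mult_if_quad_norm_mult[OF quad_norm_quat_mult], simp)

lemma composition_algebra_octonion:
  "orthonormal_basis e \<Longrightarrow> composition_algebra oct_mult e"
proof unfold_locales
  note q = bilinear_ladd[OF bilinear_quat_mult] bilinear_radd[OF bilinear_quat_mult]
    bilinear_lmul[OF bilinear_quat_mult] bilinear_rmul[OF bilinear_quat_mult]
  have c: "quat_cnj (x + y) = quat_cnj x + quat_cnj y" "quat_cnj (r *\<^sub>R x) = r *\<^sub>R quat_cnj x" for x y r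
    by (simp_all add: quat_cnj_def cd_cnj_def)
  show "bilinear oct_mult"
    by (auto simp: bilinear_def linear_iff oct_mult_def cd_mult_def q c algebra_simps)
qed (rule norm_mult_if_quad_norm_mult[OF quad_norm_oct_mult], simp)

theorem theorem6p6:
  shows "(\<forall>e :: 2 \<Rightarrow> complex. orthonormal_basis e \<longrightarrow>
           isomorphic_vector_bundles TYPE(2)
             (deletion_bundle TYPE(3) (*) e)
             (whitney_power TYPE(2) (taut_bundle TYPE(3)))) \<and>
         (\<forall>e :: 4 \<Rightarrow> quaternion. orthonormal_basis e \<longrightarrow>
           isomorphic_vector_bundles TYPE(4)
             (deletion_bundle TYPE(5) quat_mult e)
             (whitney_power TYPE(4) (taut_bundle TYPE(5)))) \<and>
         (\<forall>e :: 8 \<Rightarrow> octonion. orthonormal_basis e \<longrightarrow>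
           isomorphic_vector_bundles TYPE(8)
             (deletion_bundle TYPE(9) oct_mult e)
             (whitney_power TYPE(8) (taut_bundle TYPE(9))))"
  by (intro conjI allI impI composition_algebra.deletion_bundle_isomorphic_taut_power
      composition_algebra_complex composition_algebra_quaternion composition_algebra_octonion) simp_all

end
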